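(* Let $n\in\mathbb{N}$ and let $\mathfrak{N}$ be the class of non-degenerate ReLU networks with integer weights and biases, with $n$ input nodes, realizing functions $f:[0,1]^n\to[0,1]$. For $k\in\mathbb{N}$, let $I_k=\{0,1/k,\dots,(k-1)/k,1\}$. Then the set of axioms $\mathcal{MV}_k$ completely identifies $\mathfrak{N}$ over $I_k^n$, that is: for all $\mathcal{N}_1,\mathcal{N}_2\in\mathfrak{N}$, if $\langle\mathcal{N}_1\rangle(x)=\langle\mathcal{N}_2\rangle(x)$ for all $x\in I_k^n$, then $\mathcal{N}_1\overset{\mathcal{MV}_k}{\sim}\mathcal{N}_2$, i.e. the formula $[\mathrm{ext}(\mathcal{N}_2)]$ is derivable from $[\mathrm{ext}(\mathcal{N}_1)]$ in finitely many steps by application of the axioms $\mathcal{MV}_k$.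
   Context: **Layered graphs and networks.** A layered graph of depth $L\ge1$ and architecture $(d_0,\dots,d_L)$, $d_L=1$, $d_j\ge 1$, has nodes partitioned into levels $V^{(j)}=\{v^{(j)}_1,\dots,v^{(j)}_{d_j}\}$, $j=0,\dots,L$, $V^{(L)}=\{v_{\rm out}\}$, with edges exactly all pairs (node of level $j-1$, node of level $j$), $j=1,\dots,L$. A neural network is a layered graph with a weight $w_{v,u}\in\mathbb{R}$ on each edge $(u,v)$ (possibly zero), a bias $b_v$ at each non-input node, and activation functions. $V^{(0)}$ are input nodes; nodes at levels $1,\dots,L-1$ are hidden. In a ReLU network ($\rho$-network) all hidden nodes have activation $\rho(t)=\max\{t,0\}$ and the output node has none; in a $\sigma$-network all non-input nodes (output included) have activation $\sigma(t)=\max\{\min\{t,1\},0\}$. The local map $\langle v\rangle$ of a node at level $j\ge 1$ is $x\mapsto\psi_v(\sum_{i'}w_{v,v^{(j-1)}_{i'}}x_{i'}+b_v)$, $x\in\mathbb{R}^{d_{j-1}}$ ($\psi_v$ the activation, or identity if none), and $\langle v_i^{(0)}\rangle(x)=x_i$. The global map $\langle\!\langle v\rangle\!\rangle:\mathbb{R}^{d_0}\to\mathbb{R}$ is obtained by composing local maps from the inputs on, and $\langle\mathcal{N}\rangle=\langle\!\langle v_{\rm out}\rangle\!\rangle$. "Realizing a function $[0,1]^n\to[0,1]$" means $d_0=n$ and $\langle\mathcal N\rangle([0,1]^n)\subseteq[0,1]$. **Non-degenerate.** A ReLU network is non-degenerate (on $[0,1]^{d_0}$) if: every hidden node $v$ satisfies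 $\langle\!\langle v\rangle\!\rangle(x)>0$ for some $x\in[0,1]^{d_0}$; every hidden node satisfies $\langle\!\langle v\rangle\!\rangle(x)=0$ for some $x\in[0,1]^{d_0}$; no two nodes at the same level have the same local map; every hidden node has at least one nonzero outgoing weight. **Formulae.** A Łukasiewicz formula is a finite string built from propositional variables $x_1,x_2,\dots$ and constants $0,1$ with binary connectives $\oplus,\odot$ and unary $\lnot$; on $[0,1]$ these are interpreted as $x\oplus y=\min\{1,x+y\}$, $x\odot y=\max\{0,x+y-1\}$, $\lnot x=1-x$. **Axioms.** $\mathcal{MV}$ consists of: $x\oplus y=y\oplus x$; $x\odot y=y\odot x$; $x\oplus(y\oplus z)=(x\oplus y)\oplus z$; $x\odot(y\odot z)=(x\odot y)\odot z$; $x\oplus\lnot x=1$; $x\odot\lnot x=0$; $x\oplus1=1$; $x\odot0=0$; $x\oplus0=x$; $x\odot1=x$; $\lnot(x\oplus y)=\lnot x\odot\lnot y$; $\lnot(x\odot y)=\lnot x\oplus\lnot y$; $x=\lnot(\lnot x)$; $\lnot0=1$; $(x\odot\lnot y)\oplus y=(y\odot\lnot x)\oplus x$; $(x\oplus\lnot y)\odot y=(y\oplus\lnot x)\odot x$. Write $\oplus^jx$ and $\odot^jx$ for the $j$-fold disjunction $x\oplus\dots\oplus x$ and conjunction $x\odot\dots\odot x$ (with a fixed bracketing, immaterial by associativity). $\mathcal{MV}_1$ is $\mathcal{MV}$ together with $x\oplus x=x$. For $k\ge2$, $\mathcal{MV}_k$ is $\mathcal{MV}$ together with $\oplus^{k+1}x=\oplus^kx$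 and $\odot^{k+1}\bigl(\oplus^{j}(\odot^{j-1}x)\bigr)=\oplus^{k+1}(\odot^{j}x)$ for every $j\in\{2,\dots,k-1\}$ that does not divide $k$. **Derivation.** An equation $\gamma=\gamma'$ instantiates an axiom $\epsilon=\epsilon'$ if, for some substitution of formulae for variables applied to both sides, it becomes $\gamma=\gamma'$ or $\gamma'=\gamma$. A derivation step replaces one occurrence of a subformula $\gamma$ by $\gamma'$ where $\gamma=\gamma'$ instantiates an axiom. For a set $\mathcal{E}$ of axioms, $\tau\overset{\mathcal{E}}{\sim}\tau'$ means $\tau'$ is reached from $\tau$ by finitely many (possibly zero) steps using axioms of $\mathcal{E}$. **Substitution graphs.** A substitution graph is a layered graph with a formula $[v]$ at each node: $[v_i^{(0)}]=x_i$, and a node at level $j\ge1$ carries a formula in the variables $x_1,\dots,x_{d_{j-1}}$, $x_{i'}$ referring to the parent $v^{(j-1)}_{i'}$. The represented formula $[\mathcal{G}]$ is obtained from $[v_{\rm out}]$ by simultaneously replacing each $x_{i'}$ by $[v_{i'}^{(L-1)}]$, then in the result each $x_{i'}$ by $[v_{i'}^{(L-2)}]$, and so on down to level $0$. **Extraction.** For a ReLU network $\mathcal{N}$ with integer weights and biases and $[0,1]$-valued on $[0,1]^{d_0}$, $\mathrm{ext}(\mathcal{N})$ is defined as follows. *Step I.* For $j=1,\dots,L-1$ in this order, for each node $v$ of level $j$ compute $\mathcal{L}_v=b_v+\sum_u\max\{w_{v,u},0\}$ over its (already converted) parents $u$. If $\mathcal{L}_v\le1$, replace its activation by $\sigma$;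 if $\mathcal{L}_v>1$, replace $v$ by $\lceil\mathcal{L}_v\rceil$ $\sigma$-nodes with the same incoming and outgoing weights and biases $b_v,b_v-1,\dots,b_v-\lceil\mathcal{L}_v\rceil+1$ (nodes of each new level enumerated in a fixed order). Finally apply $\sigma$ at the output node. *Step II.* Each input node gets $x_i$; each non-input node with local map $\sigma(f)$ gets $\mathtt{EXTR}(\sigma(f))$, where for $f=m_1x_1+\dots+m_nx_n+b$ with integer coefficients, with min $\ell$ and max $\mathcal{L}$ over $[0,1]^n$: return $1$ if $\ell\ge1$; return $0$ if $\mathcal{L}\le0$; otherwise let $p$ be the smallest index with $m_p\ne0$; if $m_p\ge1$ return $(\mathtt{EXTR}(\sigma(f-x_p))\oplus x_p)\odot\mathtt{EXTR}(\sigma(f-x_p+1))$; if $m_p\le-1$ return $\lnot\,\mathtt{EXTR}(\sigma(1-f))$; occurrences $0\oplus\tau$ and $\tau\odot1$ produced by the recursion are simplified to $\tau$. $\mathrm{ext}(\mathcal N)$ is the layered graph of the $\sigma$-network from Step I with the node formulae of Step II. **Network derivation.** $\mathcal{N}_1\overset{\mathcal{E}}{\sim}\mathcal{N}_2$ means $[\mathrm{ext}(\mathcal{N}_1)]\overset{\mathcal{E}}{\sim}[\mathrm{ext}(\mathcal{N}_2)]$. *)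

theory Defs
  imports Complex_Main
begin

section \<open>Networks\<close>

text \<open>Points of \<open>\<real>\<^sup>d\<close> are real lists of length \<open>d\<close>; indices start at 0.\<close>

definition cube :: "nat \<Rightarrow> real list set" where
  "cube d = {x. length x = d \<and> set x \<subseteq> {0..1}}"

definition grid :: "nat \<Rightarrow> nat \<Rightarrow> real list set" where
  "grid k d = {x. length x = d \<and> set x \<subseteq> {real i / real k | i. i \<le> k}}"

definition affine :: "real list \<Rightarrow> real \<Rightarrow> real list \<Rightarrow> real" where
  "affine w b x = (\<Sum>i<length w. w ! i * x ! i) + b"

definition relu :: "real \<Rightarrow> real" where
  "relu t = max t 0"

definition clip :: "real \<Rightarrow> real" where
  "clip t = max (min t 1) 0"

text \<open>The \<open>i\<close>-th entry of \<open>weights v\<close> is the weight of the edge from the \<open>i\<close>-th node of the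
  preceding level to \<open>v\<close>; a node without activation has activation \<^term>\<open>id\<close>.\<close>

record node =
  act :: "real \<Rightarrow> real"
  weights :: "real list"
  bias :: real

text \<open>The entry \<open>layers N ! j\<close> is the level \<open>j + 1\<close>, so the depth is \<open>length (layers N)\<close>.\<close>

record network =
  inputs :: nat
  layers :: "node list list"

abbreviation depth :: "network \<Rightarrow> nat" where
  "depth N \<equiv> length (layers N)"

definition width :: "network \<Rightarrow> nat \<Rightarrow> nat" where
  "width N j = (if j = 0 then inputs N else length (layers N ! (j - 1)))"

definition net_node :: "network \<Rightarrow> nat \<Rightarrow> nat \<Rightarrow> node" where
  "net_node N j i = layers N ! (j - 1) ! i"

definition layered :: "network \<Rightarrow> bool" where
  "layered N \<longleftrightarrow> 1 \<le> depth N \<and> (\<forall>j\<le>depth N. 1 \<le> width N j) \<and> width N (depth N) = 1 \<and>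
    (\<forall>j\<in>{1..depth N}. \<forall>i<width N j. length (weights (net_node N j i)) = width N (j - 1))"

definition local_map :: "node \<Rightarrow> real list \<Rightarrow> real" where
  "local_map v x = act v (affine (weights v) (bias v) x)"

primrec level_map :: "network \<Rightarrow> nat \<Rightarrow> real list \<Rightarrow> real list" where
  "level_map N 0 x = x"
| "level_map N (Suc j) x = map (\<lambda>v. local_map v (level_map N j x)) (layers N ! j)"

definition global_map :: "network \<Rightarrow> nat \<Rightarrow> nat \<Rightarrow> real list \<Rightarrow> real" where
  "global_map N j i x = level_map N j x ! i"

definition realized_map :: "network \<Rightarrow> real list \<Rightarrow> real" where
  "realized_map N = global_map N (depth N) 0"

definition relu_network :: "network \<Rightarrow> bool" where
  "relu_network N \<longleftrightarrow> layered N \<and>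
    (\<forall>j\<in>{1..<depth N}. \<forall>i<width N j. act (net_node N j i) = relu) \<and>
    act (net_node N (depth N) 0) = id"

definition integer_network :: "network \<Rightarrow> bool" where
  "integer_network N \<longleftrightarrow> (\<forall>j\<in>{1..depth N}. \<forall>i<width N j.
    set (weights (net_node N j i)) \<subseteq> \<int> \<and> bias (net_node N j i) \<in> \<int>)"

text \<open>Distinctness of local maps is only required explicitly at the non-input levels: the input
  nodes have the coordinate projections as local maps.\<close>

definition nondegenerate :: "network \<Rightarrow> bool" where
  "nondegenerate N \<longleftrightarrow>
    (\<forall>j\<in>{1..<depth N}. \<forall>i<width N j. \<exists>x\<in>cube (inputs N). global_map N j i x > 0) \<and>
    (\<forall>j\<in>{1..<depth N}. \<forall>i<width N j. \<exists>x\<in>cube (inputs N). global_map N j i x = 0) \<and>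
    (\<forall>j\<in>{1..depth N}. \<forall>i<width N j. \<forall>i'<width N j. i \<noteq> i' \<longrightarrow>
      (\<exists>x. length x = width N (j - 1) \<and>
        local_map (net_node N j i) x \<noteq> local_map (net_node N j i') x)) \<and>
    (\<forall>j\<in>{1..<depth N}. \<forall>i<width N j. \<exists>i'<width N (Suc j).
      weights (net_node N (Suc j) i') ! i \<noteq> 0)"

definition network_class :: "nat \<Rightarrow> network set" where
  "network_class n = {N. relu_network N \<and> integer_network N \<and> nondegenerate N \<and>
    inputs N = n \<and> realized_map N ` cube n \<subseteq> {0..1}}"


section \<open>Formulae and derivations\<close>

text \<open>\<open>Var i\<close> is the propositional variable \<open>x\<close> with index \<open>i + 1\<close>.\<close>

datatype form =
    Var nat
  | Zero
  | One
  | Oplus form form  (infixl \<open>\<^bold>\<oplus>\<close> 65)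
  | Odot form form  (infixl \<open>\<^bold>\<odot>\<close> 70)
  | Neg form  (\<open>\<^bold>\<not> _\<close> [80] 80)

primrec subst :: "(nat \<Rightarrow> form) \<Rightarrow> form \<Rightarrow> form" where
  "subst s (Var i) = s i"
| "subst s Zero = Zero"
| "subst s One = One"
| "subst s (t \<^bold>\<oplus> u) = subst s t \<^bold>\<oplus> subst s u"
| "subst s (t \<^bold>\<odot> u) = subst s t \<^bold>\<odot> subst s u"
| "subst s (\<^bold>\<not> t) = \<^bold>\<not> (subst s t)"

text \<open>The pair \<open>(t, u)\<close> stands for the equation \<open>t = u\<close>.\<close>

type_synonym equation = "form \<times> form"

definition MV_base :: "equation set" where
  "MV_base = (let x = Var 0; y = Var 1; z = Var 2 in
   {(x \<^bold>\<oplus> y, y \<^bold>\<oplus> x),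
    (x \<^bold>\<odot> y, y \<^bold>\<odot> x),
    (x \<^bold>\<oplus> (y \<^bold>\<oplus> z), (x \<^bold>\<oplus> y) \<^bold>\<oplus> z),
    (x \<^bold>\<odot> (y \<^bold>\<odot> z), (x \<^bold>\<odot> y) \<^bold>\<odot> z),
    (x \<^bold>\<oplus> \<^bold>\<not> x, One),
    (x \<^bold>\<odot> \<^bold>\<not> x, Zero),
    (x \<^bold>\<oplus> One, One),
    (x \<^bold>\<odot> Zero, Zero),
    (x \<^bold>\<oplus> Zero, x),
    (x \<^bold>\<odot> One, x),
    (\<^bold>\<not> (x \<^bold>\<oplus> y), \<^bold>\<not> x \<^bold>\<odot> \<^bold>\<not> y),
    (\<^bold>\<not> (x \<^bold>\<odot> y), \<^bold>\<not> x \<^bold>\<oplus> \<^bold>\<not> y),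
    (x, \<^bold>\<not> (\<^bold>\<not> x)),
    (\<^bold>\<not> Zero, One),
    ((x \<^bold>\<odot> \<^bold>\<not> y) \<^bold>\<oplus> y, (y \<^bold>\<odot> \<^bold>\<not> x) \<^bold>\<oplus> x),
    ((x \<^bold>\<oplus> \<^bold>\<not> y) \<^bold>\<odot> y, (y \<^bold>\<oplus> \<^bold>\<not> x) \<^bold>\<odot> x)})"

text \<open>The \<open>j\<close>-fold disjunction and conjunction, for \<open>j \<ge> 1\<close>, bracketed to the right.\<close>

definition nfold_oplus :: "nat \<Rightarrow> form \<Rightarrow> form" where
  "nfold_oplus j t = (Oplus t ^^ (j - 1)) t"

definition nfold_odot :: "nat \<Rightarrow> form \<Rightarrow> form" where
  "nfold_odot j t = (Odot t ^^ (j - 1)) t"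

definition MV :: "nat \<Rightarrow> equation set" where
  "MV k = (let x = Var 0 in
    if k = 1 then MV_base \<union> {(x \<^bold>\<oplus> x, x)}
    else MV_base \<union> {(nfold_oplus (k + 1) x, nfold_oplus k x)} \<union>
      {(nfold_odot (k + 1) (nfold_oplus j (nfold_odot (j - 1) x)),
        nfold_oplus (k + 1) (nfold_odot j x)) | j. j \<in> {2..k - 1} \<and> \<not> j dvd k})"

definition instantiates :: "equation \<Rightarrow> equation \<Rightarrow> bool" where
  "instantiates eq ax \<longleftrightarrow> (\<exists>s. (subst s (fst ax), subst s (snd ax)) \<in> {eq, (snd eq, fst eq)})"

inductive derivation_step :: "equation set \<Rightarrow> form \<Rightarrow> form \<Rightarrow> bool" for E where
  here: "ax \<in> E \<Longrightarrow> instantiates (g, g') ax \<Longrightarrow> derivation_step E g g'"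
| oplus_left: "derivation_step E t t' \<Longrightarrow> derivation_step E (t \<^bold>\<oplus> u) (t' \<^bold>\<oplus> u)"
| oplus_right: "derivation_step E u u' \<Longrightarrow> derivation_step E (t \<^bold>\<oplus> u) (t \<^bold>\<oplus> u')"
| odot_left: "derivation_step E t t' \<Longrightarrow> derivation_step E (t \<^bold>\<odot> u) (t' \<^bold>\<odot> u)"
| odot_right: "derivation_step E u u' \<Longrightarrow> derivation_step E (t \<^bold>\<odot> u) (t \<^bold>\<odot> u')"
| neg: "derivation_step E t t' \<Longrightarrow> derivation_step E (\<^bold>\<not> t) (\<^bold>\<not> t')"

definition derivable :: "equation set \<Rightarrow> form \<Rightarrow> form \<Rightarrow> bool" where
  "derivable E = (derivation_step E)\<^sup>*\<^sup>*"


section \<open>Substitution graphs\<close>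

text \<open>A substitution graph is the list of its levels \<open>0, \<dots>, L\<close>, each the list of the formulae at
  its nodes; \<open>Var i\<close> in a formula of level \<open>j + 1\<close> refers to node \<open>i\<close> of level \<open>j\<close>. The \<open>foldr\<close>
  processes the levels from \<open>L - 1\<close> down to \<open>0\<close>.\<close>

type_synonym substitution_graph = "form list list"

definition represented :: "substitution_graph \<Rightarrow> form" where
  "represented G = foldr (\<lambda>level t. subst (\<lambda>i. level ! i) t) (butlast G) (hd (last G))"


section \<open>Extraction\<close>

text \<open>The copies of a node are consecutive in the new level, and each outgoing weight is
  repeated once per copy in the next level.\<close>

definition upper_bound :: "node \<Rightarrow> real" where
  "upper_bound v = bias v + (\<Sum>w\<leftarrow>weights v. max w 0)"

definition copies :: "node \<Rightarrow> node list" where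
  "copies v = (if upper_bound v \<le> 1 then [v\<lparr>act := clip\<rparr>]
    else map (\<lambda>i. v\<lparr>act := clip, bias := bias v - real i\<rparr>) [0..<nat \<lceil>upper_bound v\<rceil>])"

definition repeat_weights :: "nat list \<Rightarrow> node \<Rightarrow> node" where
  "repeat_weights cs v = v\<lparr>weights := concat (map2 replicate cs (weights v))\<rparr>"

fun convert :: "node list list \<Rightarrow> node list list" where
  "convert [] = []"
| "convert [l] = [map (\<lambda>v. v\<lparr>act := clip\<rparr>) l]"
| "convert (l # l' # ls) =
    concat (map copies l) # convert (map (repeat_weights (map (length \<circ> copies) l)) l' # ls)"

definition step_I :: "network \<Rightarrow> network" where
  "step_I N = N\<lparr>layers := convert (layers N)\<rparr>"

definition affine_min :: "int list \<Rightarrow> int \<Rightarrow> real" where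
  "affine_min m b = Inf (affine (map of_int m) (of_int b) ` cube (length m))"

definition affine_max :: "int list \<Rightarrow> int \<Rightarrow> real" where
  "affine_max m b = Sup (affine (map of_int m) (of_int b) ` cube (length m))"

definition first_nonzero :: "int list \<Rightarrow> nat" where
  "first_nonzero m = (LEAST p. p < length m \<and> m ! p \<noteq> 0)"

definition oplus_simp :: "form \<Rightarrow> form \<Rightarrow> form" where
  "oplus_simp t u = (if t = Zero then u else t \<^bold>\<oplus> u)"

definition odot_simp :: "form \<Rightarrow> form \<Rightarrow> form" where
  "odot_simp t u = (if u = One then t else t \<^bold>\<odot> u)"

lemma first_nonzero:
  assumes "\<not> affine_min m b \<ge> 1" "\<not> affine_max m b \<le> 0"
  shows "first_nonzero m < length m" "m ! first_nonzero m \<noteq> 0"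
proof -
  have "\<exists>p<length m. m ! p \<noteq> 0"
  proof (rule ccontr)
    assume "\<not> ?thesis"
    then have "affine (map of_int m) (of_int b) = (\<lambda>x. of_int b)"
      by (auto simp: affine_def fun_eq_iff)
    moreover have "replicate (length m) 0 \<in> cube (length m)"
      by (auto simp: cube_def)
    ultimately have "affine (map of_int m) (of_int b) ` cube (length m) = {of_int b}"
      by auto
    then show False
      using assms by (auto simp: affine_min_def affine_max_def)
  qed
  then have "first_nonzero m < length m \<and> m ! first_nonzero m \<noteq> 0"
    unfolding first_nonzero_def by (rule LeastI_ex)
  then show "first_nonzero m < length m" "m ! first_nonzero m \<noteq> 0"
    by auto
qed

text \<open>\<open>extr m b\<close> is the formula extracted from the node with local map
  \<open>clip \<circ> affine m b\<close>.\<close>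

function extr :: "int list \<Rightarrow> int \<Rightarrow> form" where
  "extr m b =
    (if affine_min m b \<ge> 1 then One
     else if affine_max m b \<le> 0 then Zero
     else if m ! first_nonzero m \<ge> 1 then
       odot_simp
         (oplus_simp (extr (m[first_nonzero m := m ! first_nonzero m - 1]) b)
           (Var (first_nonzero m)))
         (extr (m[first_nonzero m := m ! first_nonzero m - 1]) (b + 1))
     else \<^bold>\<not> (extr (map uminus m) (1 - b)))"
  by pat_completeness auto

lemma sum_abs_decrement:
  assumes "p < length m" "m ! p \<ge> (1::int)"
  shows "(\<Sum>i<length m. nat \<bar>m[p := m ! p - 1] ! i\<bar>) < (\<Sum>i<length m. nat \<bar>m ! i\<bar>)"
  using assms by (intro sum_strict_mono_ex1) (auto simp: nth_list_update)

lemma first_nonzero_uminus: "first_nonzero (map uminus m) = first_nonzero m"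
  by (auto simp: first_nonzero_def intro!: arg_cong[where f = Least])

termination extr
proof (relation "measure (\<lambda>(m, b). 2 * (\<Sum>i<length m. nat \<bar>m ! i\<bar>) +
    (if m ! first_nonzero m < 0 then 1 else 0))"; (elim conjE)?)
  fix m :: "int list" and b :: int
  let ?p = "first_nonzero m"
  assume a: "\<not> affine_min m b \<ge> 1" "\<not> affine_max m b \<le> 0"
  note p = first_nonzero[OF a]
  {
    assume "m ! ?p \<ge> 1"
    with sum_abs_decrement[OF p(1)] show
      "((m[?p := m ! ?p - 1], b), m, b) \<in> measure (\<lambda>(m, b). 2 * (\<Sum>i<length m. nat \<bar>m ! i\<bar>) +
        (if m ! first_nonzero m < 0 then 1 else 0))"
      "((m[?p := m ! ?p - 1], b + 1), m, b) \<in> measure (\<lambda>(m, b). 2 * (\<Sum>i<length m. nat \<bar>m ! i\<bar>) +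
        (if m ! first_nonzero m < 0 then 1 else 0))"
      by auto
  }
  assume "\<not> m ! ?p \<ge> 1"
  with p show "((map uminus m, 1 - b), m, b) \<in> measure (\<lambda>(m, b).
      2 * (\<Sum>i<length m. nat \<bar>m ! i\<bar>) + (if m ! first_nonzero m < 0 then 1 else 0))"
    by (auto simp: first_nonzero_uminus)
qed auto

declare extr.simps [simp del]

text \<open>Weights and biases are integers wherever \<open>ext\<close> is used, so the floors only change the type.\<close>

definition ext :: "network \<Rightarrow> substitution_graph" where
  "ext N = map Var [0..<inputs N] #
    map (map (\<lambda>v. extr (map floor (weights v)) \<lfloor>bias v\<rfloor>)) (layers (step_I N))"

definition net_derivable :: "equation set \<Rightarrow> network \<Rightarrow> network \<Rightarrow> bool" where
  "net_derivable E N\<^sub>1 N\<^sub>2 \<longleftrightarrow> derivable E (represented (ext N\<^sub>1)) (represented (ext N\<^sub>2))"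

definition completely_identifies ::
    "equation set \<Rightarrow> network set \<Rightarrow> real list set \<Rightarrow> bool" where
  "completely_identifies E \<NN> D \<longleftrightarrow> (\<forall>N\<^sub>1\<in>\<NN>. \<forall>N\<^sub>2\<in>\<NN>.
    (\<forall>x\<in>D. realized_map N\<^sub>1 x = realized_map N\<^sub>2 x) \<longrightarrow> net_derivable E N\<^sub>1 N\<^sub>2)"

end

theory Submission
  imports Defs
begin

text \<open>Extraction is sound: evaluated at a point of the cube, the formula \<open>represented (ext N)\<close> gives
  the value of \<open>N\<close> there. Hence it suffices to show that two formulae that agree under all valuations
  in the chain \<open>{0, 1/k, \<dots>, 1}\<close> are \<open>MV k\<close>-equivalent. If they are not, then one of the two
  implications between them lies outside the deductive set of the provable formulae, and by Zorn's
  lemma outside some prime deductive set \<open>M\<close> that contains it. Modulo \<open>M\<close> the Lindenbaum algebra is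
  a chain in which \<open>(k + 1) x = k x\<close>; an element of maximal order \<open>m\<close> is an atom and generates the
  chain, which is therefore \<open>{0, 1/m, \<dots>, 1}\<close>. The remaining axioms of \<open>MV k\<close> force \<open>m\<close> to divide
  \<open>k\<close>, so the quotient map is a valuation in \<open>{0, 1/k, \<dots>, 1}\<close> that separates the two formulae.\<close>


section \<open>MV-algebras and prime deductive sets\<close>

text \<open>Chang's algebras in the signature of sum and negation: top is
  \<open>\<sim> \<zero>\<close> and the product of x and y is the term
  \<open>\<sim> (\<sim> x \<oplus> \<sim> y)\<close>. A type class lets the Lindenbaum algebra
  inherit everything below by instantiation.\<close>

class mv_algebra =
  fixes add :: "'a \<Rightarrow> 'a \<Rightarrow> 'a"  (infixl "\<oplus>" 65)
    and neg :: "'a \<Rightarrow> 'a"  ("\<sim> _" [80] 80)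
    and bot :: 'a ("\<zero>")
  assumes add_comm: "x \<oplus> y = y \<oplus> x"
    and add_assoc: "x \<oplus> y \<oplus> z = x \<oplus> (y \<oplus> z)"
    and add_bot: "x \<oplus> \<zero> = x"
    and neg_neg: "\<sim> (\<sim> x) = x"
    and add_top: "x \<oplus> \<sim> \<zero> = \<sim> \<zero>"
    and join_comm: "\<sim> (\<sim> x \<oplus> y) \<oplus> y = \<sim> (\<sim> y \<oplus> x) \<oplus> x"
begin

lemma add_lcomm: "x \<oplus> (y \<oplus> z) = y \<oplus> (x \<oplus> z)"
  by (metis add_assoc add_comm)

lemmas add_ac = add_assoc add_comm add_lcomm

lemma add_neg: "x \<oplus> \<sim> x = \<sim> \<zero>"
  by (metis add_bot add_comm add_top join_comm neg_neg)

lemma top_add: "\<sim> \<zero> \<oplus> x = \<sim> \<zero>"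
  by (metis add_comm add_top)

lemma bot_add: "\<zero> \<oplus> x = x"
  by (metis add_comm add_bot)

lemma add_neg_left: "x \<oplus> (\<sim> x \<oplus> y) = \<sim> \<zero>"
  by (metis add_assoc add_neg top_add)

section \<open>Implication, supremum and prelinearity\<close>

definition imp :: "'a \<Rightarrow> 'a \<Rightarrow> 'a"  (infixr "\<rightarrow>" 60)
  where "x \<rightarrow> y = \<sim> x \<oplus> y"

text \<open>The Lukasiewicz term for the lattice supremum; \<open>join_comm\<close> is exactly its
  commutativity.\<close>

definition join :: "'a \<Rightarrow> 'a \<Rightarrow> 'a"  (infixl "\<squnion>" 63)
  where "x \<squnion> y = ((x \<rightarrow> y) \<rightarrow> y)"

lemma join_commute: "x \<squnion> y = y \<squnion> x"
  by (simp add: join_def imp_def join_comm)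

lemma imp_refl: "x \<rightarrow> x = \<sim> \<zero>"
  by (metis imp_def add_comm add_neg)

lemma imp_weaken: "x \<rightarrow> (y \<rightarrow> x) = \<sim> \<zero>"
  by (metis imp_def add_ac add_neg_left)

lemma top_imp: "\<sim> \<zero> \<rightarrow> x = x"
  by (metis imp_def neg_neg bot_add)

lemma bot_imp: "\<zero> \<rightarrow> x = \<sim> \<zero>"
  by (metis imp_def top_add)

lemma imp_add: "x \<rightarrow> x \<oplus> y = \<sim> \<zero>"
  by (metis imp_def add_ac add_neg_left)

text \<open>Expanded, the term is the sum of two joins, of \<sim> x with \<sim> y and of y with z.
  Commuting both exposes the summands \<sim> y and y, which add up to top.\<close>

lemma imp_trans: "(x \<rightarrow> y) \<rightarrow> (y \<rightarrow> z) \<rightarrow> (x \<rightarrow> z) = \<sim> \<zero>"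
proof -
  have "(x \<rightarrow> y) \<rightarrow> (y \<rightarrow> z) \<rightarrow> (x \<rightarrow> z)
      = (\<sim> (\<sim> x \<oplus> y) \<oplus> \<sim> x) \<oplus> (\<sim> (\<sim> y \<oplus> z) \<oplus> z)"
    by (simp add: imp_def add_ac)
  also have "\<sim> (\<sim> x \<oplus> y) \<oplus> \<sim> x = \<sim> (x \<oplus> \<sim> y) \<oplus> \<sim> y"
    by (metis join_comm neg_neg add_comm)
  also have "\<sim> (\<sim> y \<oplus> z) \<oplus> z = \<sim> (\<sim> z \<oplus> y) \<oplus> y"
    by (rule join_comm)
  finally show ?thesis
    by (metis add_ac add_neg_left)
qed

text \<open>Commuting the join of x and y inside the expanded term frees a summand x; together with
  z it meets the summand \<sim> (x \<oplus> z).\<close>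

lemma imp_add_mono: "(x \<rightarrow> y) \<rightarrow> (x \<oplus> z \<rightarrow> y \<oplus> z) = \<sim> \<zero>"
proof -
  have "(x \<rightarrow> y) \<rightarrow> (x \<oplus> z \<rightarrow> y \<oplus> z) = (\<sim> (\<sim> x \<oplus> y) \<oplus> y) \<oplus> (z \<oplus> \<sim> (x \<oplus> z))"
    by (simp add: imp_def add_ac)
  also have "\<sim> (\<sim> x \<oplus> y) \<oplus> y = \<sim> (\<sim> y \<oplus> x) \<oplus> x"
    by (rule join_comm)
  also have "\<sim> (\<sim> y \<oplus> x) \<oplus> x \<oplus> (z \<oplus> \<sim> (x \<oplus> z)) = \<sim> (\<sim> y \<oplus> x) \<oplus> ((x \<oplus> z) \<oplus> \<sim> (x \<oplus> z))"
    by (metis add_assoc)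
  finally show ?thesis
    by (simp add: add_neg add_top)
qed

text \<open>Turns the absorption of x by y into a join, so that primeness can split it.\<close>

lemma join_neg: "\<sim> x \<squnion> y = (x \<oplus> y \<rightarrow> y)"
  by (simp add: join_def imp_def neg_neg)

text \<open>This makes the order modulo a prime deductive set total. The calculation only commutes
  joins, in the form \<open>jn\<close>, until x and \<sim> x occur as summands; here s is y
  \<rightarrow> x and a is the product of s and x.\<close>

lemma prelinear: "(x \<rightarrow> y) \<squnion> (y \<rightarrow> x) = \<sim> \<zero>"
proof -
  define v where "v = \<sim> y"
  define s where "s = x \<oplus> v"
  define a where "a = \<sim> (\<sim> s \<oplus> \<sim> x)"
  have jn: "\<sim> (\<sim> p \<oplus> \<sim> q) \<oplus> \<sim> q = p \<oplus> \<sim> (q \<oplus> p)" for p q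
    by (metis join_comm neg_neg add_comm)
  have "(x \<rightarrow> y) \<squnion> (y \<rightarrow> x) = \<sim> (s \<oplus> \<sim> (\<sim> x \<oplus> \<sim> v)) \<oplus> s"
    by (simp add: join_def imp_def v_def s_def neg_neg add_ac)
  also have "\<dots> = \<sim> (\<sim> s \<oplus> (\<sim> x \<oplus> \<sim> v)) \<oplus> (\<sim> x \<oplus> \<sim> v)"
    by (metis jn add_comm neg_neg)
  also have "\<dots> = \<sim> (\<sim> a \<oplus> \<sim> v) \<oplus> \<sim> v \<oplus> \<sim> x"
    by (simp add: a_def neg_neg add_ac)
  also have "\<dots> = \<sim> (\<sim> s \<oplus> \<sim> x) \<oplus> \<sim> x \<oplus> \<sim> (v \<oplus> a)"
    unfolding jn[of a v] by (simp add: a_def add_ac)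
  also have "\<dots> = s \<oplus> \<sim> (x \<oplus> s) \<oplus> \<sim> (v \<oplus> a)"
    unfolding jn ..
  also have "\<dots> = x \<oplus> \<sim> (x \<oplus> s) \<oplus> (\<sim> (\<sim> (\<sim> v) \<oplus> a) \<oplus> v)"
    by (simp add: s_def neg_neg add_ac)
  also have "\<sim> (\<sim> (\<sim> v) \<oplus> a) \<oplus> v = \<sim> (\<sim> v \<oplus> \<sim> a) \<oplus> \<sim> a"
    by (metis jn add_comm neg_neg)
  also have "\<sim> a = \<sim> s \<oplus> \<sim> x"
    by (simp add: a_def neg_neg)
  finally show ?thesis
    by (metis add_ac add_neg_left)
qed

section \<open>Deductive sets and prime extensions\<close>

primrec mul :: "nat \<Rightarrow> 'a \<Rightarrow> 'a" where
  "mul 0 x = \<zero>"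
| "mul (Suc n) x = x \<oplus> mul n x"

lemma mul_add: "mul (i + j) x = mul i x \<oplus> mul j x"
  by (induction i) (simp_all add: bot_add add_assoc)

lemma mul_distrib: "mul n (x \<oplus> y) = mul n x \<oplus> mul n y"
  by (induction n) (simp_all add: bot_add add_ac)

text \<open>These are the implicative filters: modus ponens, rather than ideal closure, matches the
  set of provable formulae.\<close>

definition deductive :: "'a set \<Rightarrow> bool" where
  "deductive M \<longleftrightarrow> \<sim> \<zero> \<in> M \<and> (\<forall>x y. x \<in> M \<longrightarrow> (x \<rightarrow> y) \<in> M \<longrightarrow> y \<in> M)"

lemma deductive_top: "deductive M \<Longrightarrow> \<sim> \<zero> \<in> M"
  by (simp add: deductive_def)

lemma deductive_mp: "deductive M \<Longrightarrow> x \<in> M \<Longrightarrow> (x \<rightarrow> y) \<in> M \<Longrightarrow> y \<in> M"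
  unfolding deductive_def by blast

lemma deductive_add:
  assumes "deductive M" "x \<in> M" shows "y \<oplus> x \<in> M"
proof (rule deductive_mp[OF assms])
  have "x \<rightarrow> y \<oplus> x = \<sim> \<zero>"
    using imp_add[of x y] by (simp add: add_comm)
  then show "x \<rightarrow> y \<oplus> x \<in> M"
    by (simp add: deductive_top[OF assms(1)])
qed

lemma deductive_trans:
  assumes "deductive M" "(x \<rightarrow> y) \<in> M" "(y \<rightarrow> z) \<in> M" shows "(x \<rightarrow> z) \<in> M"
  using imp_trans[of x y z] assms by (metis deductive_def)

text \<open>Disjunction elimination. Applying transitivity twice to a \<rightarrow> w turns the join
  of a and b into the join of w and b; read in the other order, it yields w from b \<rightarrow>
  w.\<close>

lemma deductive_join_elim:
  assumes M: "deductive M" and "a \<squnion> b \<in> M" "(a \<rightarrow> w) \<in> M" "(b \<rightarrow> w) \<in> M" shows "w \<in> M"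
proof -
  have "(w \<rightarrow> b) \<rightarrow> (a \<rightarrow> b) \<in> M"
    using imp_trans[of a w b] assms by (metis deductive_def)
  then have "((a \<rightarrow> b) \<rightarrow> b) \<rightarrow> ((w \<rightarrow> b) \<rightarrow> b) \<in> M"
    using imp_trans[of "w \<rightarrow> b" "a \<rightarrow> b" b] assms by (metis deductive_def)
  then have "((w \<rightarrow> b) \<rightarrow> b) \<in> M"
    using assms by (metis deductive_def join_def)
  then have "((b \<rightarrow> w) \<rightarrow> w) \<in> M"
    by (metis join_commute join_def)
  then show ?thesis
    using assms by (metis deductive_def)
qed

text \<open>\<open>mul n (\<sim> x) \<oplus> y\<close> says that the n-fold product of x implies y,
  so this is the deductive set generated by M and x. Under modus ponens the exponents add.\<close>

lemma deductive_generated: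
  assumes M: "deductive M"
  shows "deductive {y. \<exists>n. mul n (\<sim> x) \<oplus> y \<in> M}"
  unfolding deductive_def
proof (intro conjI allI impI CollectI; (elim CollectE exE)?)
  show "\<exists>n. mul n (\<sim> x) \<oplus> \<sim> \<zero> \<in> M"
    using M by (simp add: add_top deductive_top)
  fix y z i j
  assume i: "mul i (\<sim> x) \<oplus> y \<in> M" and j: "mul j (\<sim> x) \<oplus> (y \<rightarrow> z) \<in> M"
  define a b where "a = mul i (\<sim> x)" and "b = mul j (\<sim> x)"
  have "\<sim> a \<rightarrow> y \<in> M" "y \<rightarrow> b \<oplus> z \<in> M"
    using i j by (simp_all add: a_def b_def imp_def neg_neg add_ac)
  then have "\<sim> a \<rightarrow> b \<oplus> z \<in> M"
    using deductive_trans[OF M] by blast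
  then show "\<exists>n. mul n (\<sim> x) \<oplus> z \<in> M"
    by (intro exI[of _ "i + j"]) (simp add: imp_def mul_add neg_neg a_def b_def add_ac)
qed

definition prime_filter :: "'a set \<Rightarrow> bool" where
  "prime_filter M \<longleftrightarrow> deductive M \<and> \<zero> \<notin> M \<and> (\<forall>x y. x \<squnion> y \<in> M \<longrightarrow> x \<in> M \<or> y \<in> M)"

text \<open>Each use of disjunction elimination removes one copy of \<sim> a; in the branch for b
  the remaining copies are merely added on the left.\<close>

lemma deductive_join_elim_mul:
  assumes M: "deductive M" and ab: "a \<squnion> b \<in> M" and b: "(b \<rightarrow> u) \<in> M"
  shows "mul n (\<sim> a) \<oplus> u \<in> M \<Longrightarrow> u \<in> M"
proof (induction n)
  case (Suc n)
  have "a \<rightarrow> mul n (\<sim> a) \<oplus> u \<in> M"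
    using Suc.prems by (simp add: imp_def add_ac)
  moreover have "b \<rightarrow> mul n (\<sim> a) \<oplus> u \<in> M"
    using deductive_add[OF M b, of "mul n (\<sim> a)"] by (simp add: imp_def add_ac)
  ultimately show ?case
    using Suc.IH deductive_join_elim[OF M ab] by blast
qed (simp add: bot_add)

text \<open>If a and b were both outside M, maximality would put w into both generated sets, so
  powers of a and of b would imply w modulo M. Their join then forces w into M.\<close>

lemma maximal_deductive_prime:
  assumes M: "deductive M" and w: "w \<notin> M"
    and max: "\<And>G. deductive G \<Longrightarrow> M \<subseteq> G \<Longrightarrow> w \<notin> G \<Longrightarrow> G = M"
  shows "prime_filter M"
  unfolding prime_filter_def
proof (intro conjI allI impI)
  show "\<zero> \<notin> M"
    using w deductive_mp[OF M, of \<zero> w] deductive_top[OF M] by (auto simp: bot_imp)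
  have gen: "\<exists>n. mul n (\<sim> x) \<oplus> w \<in> M" if "x \<notin> M" for x
  proof -
    let ?G = "{y. \<exists>n. mul n (\<sim> x) \<oplus> y \<in> M}"
    have "mul 0 (\<sim> x) \<oplus> y \<in> M" if "y \<in> M" for y
      using that by (simp add: bot_add)
    then have "M \<subseteq> ?G"
      by blast
    moreover have "x \<in> ?G"
      using deductive_top[OF M] by (auto intro!: exI[of _ 1] simp: add_bot add_comm[of "\<sim> x"] add_neg)
    ultimately show ?thesis
      using max[OF deductive_generated[OF M, of x]] that by blast
  qed
  fix a b assume ab: "a \<squnion> b \<in> M"
  show "a \<in> M \<or> b \<in> M"
  proof (rule ccontr)
    assume "\<not> ?thesis"
    then have "a \<notin> M" "b \<notin> M"
      by simp_all
    then obtain i j where i: "mul i (\<sim> a) \<oplus> w \<in> M" and j: "mul j (\<sim> b) \<oplus> w \<in> M"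
      by (elim gen[THEN exE])
    \<comment> \<open>The copies of \<sim> b are peeled off one at a time, and for each of them all
      i copies of \<sim> a are removed by the preceding lemma.\<close>
    from j have "w \<in> M"
    proof (induction j)
      case (Suc j)
      have "mul i (\<sim> a) \<oplus> (mul j (\<sim> b) \<oplus> w) \<in> M"
        using deductive_add[OF M i, of "mul j (\<sim> b)"] by (simp add: add_lcomm)
      moreover have "b \<rightarrow> mul j (\<sim> b) \<oplus> w \<in> M"
        using Suc.prems by (simp add: imp_def add_ac)
      ultimately show ?case
        using deductive_join_elim_mul[OF M ab] Suc.IH by blast
    qed (simp add: bot_add)
    with w show False ..
  qed
qed (fact M)

lemma prime_filter_exists:
  assumes F: "deductive F" and w: "w \<notin> F"
  obtains M where "prime_filter M" "F \<subseteq> M" "w \<notin> M"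
proof -
  let ?\<A> = "{G. deductive G \<and> F \<subseteq> G \<and> w \<notin> G}"
  have "\<exists>M\<in>?\<A>. \<forall>X\<in>?\<A>. M \<subseteq> X \<longrightarrow> X = M"
  proof (rule subset_Zorn_nonempty)
    show "?\<A> \<noteq> {}"
      using assms by blast
    fix \<C> assume "\<C> \<noteq> {}" and C: "subset.chain ?\<A> \<C>"
    have "deductive (\<Union> \<C>)"
      unfolding deductive_def
    proof (intro conjI allI impI)
      show "\<sim> \<zero> \<in> \<Union> \<C>"
        using C \<open>\<C> \<noteq> {}\<close> deductive_top unfolding subset_chain_def by blast
      fix x y assume "x \<in> \<Union> \<C>" "x \<rightarrow> y \<in> \<Union> \<C>"
      then obtain G where "G \<in> \<C>" "x \<in> G" "x \<rightarrow> y \<in> G"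
        using C unfolding subset_chain_def by blast
      then show "y \<in> \<Union> \<C>"
        using C deductive_mp unfolding subset_chain_def by blast
    qed
    then show "\<Union> \<C> \<in> ?\<A>"
      using C \<open>\<C> \<noteq> {}\<close> unfolding subset_chain_def by blast
  qed
  then obtain M where "deductive M" "F \<subseteq> M" "w \<notin> M"
      and "\<And>G. deductive G \<Longrightarrow> M \<subseteq> G \<Longrightarrow> w \<notin> G \<Longrightarrow> G = M"
    by (smt (verit) mem_Collect_eq order_trans)
  with maximal_deductive_prime that show thesis
    by blast
qed

lemma deductive_imp_top: "deductive M \<Longrightarrow> y \<in> M \<Longrightarrow> x \<rightarrow> y \<in> M"
  by (metis deductive_mp deductive_top imp_weaken)

section \<open>The finite chain modulo a prime deductive set\<close>

context
  fixes M
  assumes M: "prime_filter M"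
begin

text \<open>The quotient by M is never formed: its order is handled as a preorder on
  representatives, and equality modulo M means that both directions hold.\<close>

abbreviation le (infix "\<preceq>" 50) where "x \<preceq> y \<equiv> (x \<rightarrow> y) \<in> M"

lemma ded: "deductive M"
  using M by (simp add: prime_filter_def)

lemma le_refl: "x \<preceq> x"
  by (simp add: imp_refl deductive_top[OF ded])

lemma le_trans: "x \<preceq> y \<Longrightarrow> y \<preceq> z \<Longrightarrow> x \<preceq> z"
  using deductive_trans[OF ded] .

lemma le_total: "x \<preceq> y \<or> y \<preceq> x"
  using M prelinear[of x y] unfolding prime_filter_def by (metis deductive_top)

lemma add_mono_left: "x \<preceq> y \<Longrightarrow> x \<oplus> z \<preceq> y \<oplus> z"
  using imp_add_mono[of x y z] deductive_mp[OF ded] deductive_top[OF ded] by metis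

lemma add_mono: "x \<preceq> y \<Longrightarrow> u \<preceq> v \<Longrightarrow> x \<oplus> u \<preceq> y \<oplus> v"
  by (metis add_mono_left add_comm le_trans)

lemma le_add: "x \<preceq> x \<oplus> y"
  by (simp add: imp_add deductive_top[OF ded])

lemma bot_le: "\<zero> \<preceq> x"
  by (simp add: bot_imp deductive_top[OF ded])

lemma mem_mono: "x \<in> M \<Longrightarrow> x \<preceq> y \<Longrightarrow> y \<in> M"
  using deductive_mp[OF ded] .

lemma le_mem: "y \<in> M \<Longrightarrow> x \<preceq> y"
  by (rule deductive_imp_top[OF ded])

lemma bot_notin: "\<zero> \<notin> M"
  using M by (simp add: prime_filter_def)

lemma mul_mono: "x \<preceq> y \<Longrightarrow> mul n x \<preceq> mul n y"
  by (induction n) (auto intro: le_refl add_mono)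

lemma mul_mono_left: "i \<le> j \<Longrightarrow> mul i x \<preceq> mul j x"
  using le_add[of "mul i x" "mul (j - i) x"] by (simp add: mul_add[symmetric])

lemma le_bot_iff: "x \<preceq> \<zero> \<longleftrightarrow> \<sim> x \<in> M"
  by (simp add: imp_def add_bot)

text \<open>By \<open>join_neg\<close> the hypothesis is a join in M. This is cancellation in the
  chain: y absorbs x only if x is bottom or y is top modulo M.\<close>

lemma add_absorb: "x \<oplus> y \<preceq> y \<Longrightarrow> \<sim> x \<in> M \<or> y \<in> M"
  using M by (simp add: prime_filter_def join_neg[symmetric])

text \<open>The truncated difference, that is, the product of x with \<sim> y.\<close>

definition minus where "minus x y = \<sim> (x \<rightarrow> y)"

lemma minus_le_bot_iff: "minus x y \<preceq> \<zero> \<longleftrightarrow> x \<preceq> y"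
  by (simp add: le_bot_iff minus_def neg_neg)

text \<open>Both y plus x - y and x plus y - x are the join of x and y, and x - y is bottom modulo
  M.\<close>

lemma add_minus: "x \<preceq> y \<Longrightarrow> x \<oplus> minus y x \<preceq> y"
proof -
  assume "x \<preceq> y"
  then have "minus x y \<preceq> \<zero>"
    by (simp add: minus_le_bot_iff)
  then have "y \<oplus> minus x y \<preceq> y \<oplus> \<zero>"
    by (intro add_mono le_refl)
  moreover have "y \<oplus> minus x y = x \<oplus> minus y x"
    by (metis minus_def imp_def join_comm add_comm)
  ultimately show ?thesis
    by (simp add: add_bot)
qed

text \<open>Meaningful only when some multiple of x lies in M; in the next lemma this holds for
  every x that is not bottom modulo M.\<close>

definition ord :: "'a \<Rightarrow> nat" where "ord x = (LEAST n. mul n x \<in> M)"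

text \<open>h counts how many copies of the atom c fit below an element. The last conclusion records
  the atom, which later serves to test the divisibility axioms.\<close>

lemma chain_representation:
  assumes idem: "\<And>x. mul (Suc k) x \<preceq> mul k x"
  obtains m h where "1 \<le> m" "m \<le> k" "\<forall>x. h x \<le> m" "\<forall>x y. h (x \<oplus> y) = min m (h x + h y)"
    "\<forall>x. h (\<sim> x) = m - h x" "\<forall>x. h x = m \<longleftrightarrow> x \<in> M" "\<exists>x. h x = (1::nat)"
proof -
  \<comment> \<open>the instance of idempotence says that \<open>\<sim> x \<squnion> mul k x\<close> lies in \<open>M\<close>, and \<open>M\<close> is prime\<close>
  have arch: "mul k x \<in> M" if "\<not> x \<preceq> \<zero>" for x
    using add_absorb[of x "mul k x"] idem[of x] that by (simp add: le_bot_iff)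
  have ord: "mul (ord x) x \<in> M" if "\<not> x \<preceq> \<zero>" for x
    unfolding ord_def using arch[OF that] by (rule LeastI)
  have ord_le: "ord x \<le> n" if "mul n x \<in> M" for n x
    unfolding ord_def using that by (rule Least_le)
  define S where "S = ord ` {x. \<not> x \<preceq> \<zero>}"
  have "S \<subseteq> {..k}"
    using ord_le arch by (auto simp: S_def)
  then have "finite S"
    by (rule finite_subset) simp
  have top: "\<not> \<sim> \<zero> \<preceq> \<zero>"
    using bot_notin by (simp add: top_imp)
  then have "S \<noteq> {}"
    unfolding S_def by blast
  define m where "m = Max S"
  have "m \<in> S"
    unfolding m_def using \<open>finite S\<close> \<open>S \<noteq> {}\<close> by (rule Max_in)
  then obtain c where c: "\<not> c \<preceq> \<zero>" and m_c: "m = ord c"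
    by (auto simp: S_def)
  have mc: "mul m c \<in> M"
    using ord[OF c] m_c by simp
  have jc: "mul j c \<notin> M" if "j < m" for j
    using ord_le[of j c] that m_c by auto
  have m1: "1 \<le> m"
    using mc bot_notin by (cases m) auto
  have max: "mul m x \<in> M" if "\<not> x \<preceq> \<zero>" for x
  proof -
    have "ord x \<le> m"
      unfolding m_def using \<open>finite S\<close> that by (intro Max_ge) (auto simp: S_def)
    then show ?thesis
      using ord[OF that] mul_mono_left mem_mono by blast
  qed
  have atom: "c \<preceq> d" if d: "\<not> d \<preceq> \<zero>" for d
  proof (rule ccontr)
    assume cd: "\<not> c \<preceq> d"
    then have dc: "d \<preceq> c"
      using le_total by blast
    have z: "\<not> minus c d \<preceq> \<zero>"
      using cd by (simp add: minus_le_bot_iff)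
    \<comment> \<open>the smaller of \<open>d\<close> and \<open>c - d\<close> fits twice into \<open>c\<close>, so its order would exceed \<open>m\<close>\<close>
    obtain e where e: "\<not> e \<preceq> \<zero>" "e \<preceq> d" "e \<preceq> minus c d"
      using le_total[of d "minus c d"] d z le_refl by blast
    have "e \<oplus> e \<preceq> c"
      using add_mono[OF e(2,3)] add_minus[OF dc] le_trans by blast
    then have "mul (m - 1) (e \<oplus> e) \<preceq> mul (m - 1) c"
      by (rule mul_mono)
    moreover have "mul (m - 1) c \<notin> M"
      using jc[of "m - 1"] m1 by simp
    ultimately have "mul (m - 1 + (m - 1)) e \<notin> M"
      unfolding mul_add mul_distrib using mem_mono by blast
    \<comment> \<open>By maximality of m, already m copies of e reach the top. Only m = 1 is left,
      and then d itself is top and lies above c.\<close>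
    then have "m - 1 + (m - 1) < m"
      using max[OF e(1)] mul_mono_left[of m "m - 1 + (m - 1)" e] mem_mono not_less by blast
    then have "m = 1"
      using m1 by simp
    then have "d \<in> M"
      using max[OF d] by (simp add: add_bot)
    with cd show False
      using le_mem by blast
  qed
  \<comment> \<open>The multiples of c grow strictly up to m: a repetition would let
    \<open>mul j c\<close> absorb c before the order of c is reached.\<close>
  have inj: "i \<le> j" if "i \<le> m" "mul i c \<preceq> mul j c" for i j
  proof (rule ccontr)
    assume "\<not> i \<le> j"
    then have "mul (Suc j) c \<preceq> mul j c"
      using that mul_mono_left[of "Suc j" i c] le_trans by (meson Suc_leI not_le)
    then have "\<sim> c \<in> M \<or> mul j c \<in> M"
      using add_absorb by simp
    then show False
      using c jc[of j] \<open>\<not> i \<le> j\<close> \<open>i \<le> m\<close> by (auto simp: le_bot_iff)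
  qed
  define h where "h x = Max {j. j \<le> m \<and> mul j c \<preceq> x}" for x
  have fin: "finite {j. j \<le> m \<and> mul j c \<preceq> x}" for x
    by simp
  have h: "h x \<le> m \<and> mul (h x) c \<preceq> x" for x
    using Max_in[OF fin, of x] bot_le[of x] unfolding h_def by fastforce
  have h_ge: "j \<le> h x" if "j \<le> m" "mul j c \<preceq> x" for j x
    unfolding h_def using fin that by (intro Max_ge) auto
  \<comment> \<open>If x exceeded its h x copies of c, the difference would not be bottom, so by
    atomicity one more copy of c would fit below x.\<close>
  have h_le: "x \<preceq> mul (h x) c" for x
  proof (cases "h x = m")
    case True
    then show ?thesis
      using le_mem[OF mc] by simp
  next
    case False
    then have "Suc (h x) \<le> m"
      using h[of x] by simp
    then have n: "\<not> mul (Suc (h x)) c \<preceq> x"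
      using h_ge[of "Suc (h x)" x] by auto
    show ?thesis
    proof (rule ccontr)
      assume "\<not> ?thesis"
      then have "c \<preceq> minus x (mul (h x) c)"
        by (intro atom) (simp add: minus_le_bot_iff)
      then have "mul (h x) c \<oplus> c \<preceq> mul (h x) c \<oplus> minus x (mul (h x) c)"
        by (intro add_mono le_refl)
      then have "mul (h x) c \<oplus> c \<preceq> x"
        using add_minus h le_trans by blast
      with n show False
        by (simp add: add_comm[of c])
    qed
  qed
  have uniq: "h x = j" if "j \<le> m" "mul j c \<preceq> x" "x \<preceq> mul j c" for x j
    using that h_ge h inj le_trans by (meson order_antisym)
  have mem: "h x = m \<longleftrightarrow> x \<in> M" for x
    using h[of x] mem_mono[OF mc, of x] le_mem[of x "mul m c"] h_ge[of m x]
    by (metis order_antisym order_refl)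
  have h_add: "h (x \<oplus> y) = min m (h x + h y)" for x y
  proof (rule uniq)
    have "mul (min m (h x + h y)) c \<preceq> mul (h x + h y) c"
      by (intro mul_mono_left) simp
    then show "mul (min m (h x + h y)) c \<preceq> x \<oplus> y"
      using h add_mono le_trans unfolding mul_add by blast
    have "x \<oplus> y \<preceq> mul (h x + h y) c"
      using h_le add_mono unfolding mul_add by blast
    then show "x \<oplus> y \<preceq> mul (min m (h x + h y)) c"
      using le_mem[OF mc, of "x \<oplus> y"] by (cases "h x + h y \<le> m") (auto simp: min_def)
  qed simp
  have h_mul: "h (mul j c) = j" if "j \<le> m" for j
    using uniq[OF that] le_refl by blast
  \<comment> \<open>The lower bound holds because x and \<sim> x sum to top. For the upper bound, x
    plus m - h x copies of c is top, so \<sim> x lies below these copies.\<close>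
  have h_neg: "h (\<sim> x) = m - h x" for x
  proof -
    have "h (x \<oplus> \<sim> x) = m"
      unfolding mem by (simp add: add_neg deductive_top[OF ded])
    then have 1: "m - h x \<le> h (\<sim> x)"
      by (auto simp: h_add)
    have "h (x \<oplus> mul (m - h x) c) = m"
      using h[of x] by (simp add: h_add h_mul)
    then have "\<sim> x \<preceq> mul (m - h x) c"
      by (simp add: mem imp_def neg_neg)
    then have "mul (h (\<sim> x)) c \<preceq> mul (m - h x) c"
      using h le_trans by blast
    then show ?thesis
      using inj h 1 by (meson order_antisym)
  qed
  have "m \<le> k"
    using ord_le[OF arch[OF c]] m_c by simp
  then show thesis
    using that[of m h] m1 h h_add h_neg mem h_mul[of 1] by blast
qed

end

end


section \<open>The Lindenbaum algebra and completeness over a finite chain\<close>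

lemma derivable_refl: "derivable E t t"
  by (simp add: derivable_def)

lemma derivable_trans: "derivable E t u \<Longrightarrow> derivable E u v \<Longrightarrow> derivable E t v"
  unfolding derivable_def by (rule rtranclp_trans)

text \<open>\<open>instantiates\<close> accepts an axiom in either orientation.\<close>

lemma derivation_step_sym: "derivation_step E t u \<Longrightarrow> derivation_step E u t"
proof (induction rule: derivation_step.induct)
  case (here ax g g')
  then show ?case
    by (intro derivation_step.here[of ax]) (auto simp: instantiates_def)
qed (auto intro: derivation_step.intros)

lemma derivable_sym: "derivable E t u \<Longrightarrow> derivable E u t"
  unfolding derivable_def
  by (rule sympD[OF symp_rtranclp]) (auto intro: sympI derivation_step_sym)

lemma derivable_context:
  assumes "\<And>t u. derivation_step E t u \<Longrightarrow> derivation_step E (f t) (f u)" "derivable E t u"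
  shows "derivable E (f t) (f u)"
  using assms(2) unfolding derivable_def
  by (induction rule: rtranclp_induct) (auto intro: rtranclp.rtrancl_into_rtrancl assms(1))

lemma derivable_Neg: "derivable E t u \<Longrightarrow> derivable E (\<^bold>\<not> t) (\<^bold>\<not> u)"
  by (rule derivable_context) (rule derivation_step.neg)

lemma derivable_Oplus:
  assumes "derivable E t t'" "derivable E u u'"
  shows "derivable E (t \<^bold>\<oplus> u) (t' \<^bold>\<oplus> u')"
proof (rule derivable_trans)
  show "derivable E (t \<^bold>\<oplus> u) (t' \<^bold>\<oplus> u)"
    using assms(1) by (rule derivable_context[rotated]) (rule derivation_step.oplus_left)
  show "derivable E (t' \<^bold>\<oplus> u) (t' \<^bold>\<oplus> u')"
    using assms(2) by (rule derivable_context[rotated]) (rule derivation_step.oplus_right)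
qed

lemma derivable_mono:
  assumes "E \<subseteq> E'" "derivable E t u" shows "derivable E' t u"
proof -
  have "derivation_step E' t u" if "derivation_step E t u" for t u
    using that by induction (use assms(1) in \<open>blast intro: derivation_step.intros\<close>)+
  then show ?thesis
    using assms(2) unfolding derivable_def by (metis mono_rtranclp)
qed

lemma derivable_axiom:
  assumes "(l, r) \<in> E" shows "derivable E (subst s l) (subst s r)"
  unfolding derivable_def
  by (intro r_into_rtranclp derivation_step.here[OF assms]) (auto simp: instantiates_def)

text \<open>The base axioms mention only the variables 0, 1 and 2, so three formulae determine an
  instance.\<close>

definition assign :: "form \<Rightarrow> form \<Rightarrow> form \<Rightarrow> nat \<Rightarrow> form" where
  "assign t u v i = (if i = 0 then t else if i = 1 then u else v)"

lemma assign_simps [simp]: "assign t u v 0 = t" "assign t u v (Suc 0) = u" "assign t u v 1 = u" "assign t u v 2 = v"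
  by (simp_all add: assign_def)

context
  fixes E :: "equation set" assumes E: "MV_base \<subseteq> E"
begin

lemma MV_rules:
  "derivable E (t \<^bold>\<oplus> u) (u \<^bold>\<oplus> t)"
  "derivable E (t \<^bold>\<oplus> (u \<^bold>\<oplus> v)) (t \<^bold>\<oplus> u \<^bold>\<oplus> v)"
  "derivable E (t \<^bold>\<oplus> \<^bold>\<not> t) One"
  "derivable E (t \<^bold>\<oplus> One) One"
  "derivable E (t \<^bold>\<oplus> Zero) t"
  "derivable E (\<^bold>\<not> (t \<^bold>\<oplus> u)) (\<^bold>\<not> t \<^bold>\<odot> \<^bold>\<not> u)"
  "derivable E (\<^bold>\<not> (t \<^bold>\<odot> u)) (\<^bold>\<not> t \<^bold>\<oplus> \<^bold>\<not> u)"
  "derivable E t (\<^bold>\<not> (\<^bold>\<not> t))"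
  "derivable E (\<^bold>\<not> Zero) One"
  "derivable E (t \<^bold>\<odot> \<^bold>\<not> u \<^bold>\<oplus> u) (u \<^bold>\<odot> \<^bold>\<not> t \<^bold>\<oplus> t)"
proof -
  let ?s = "assign t u v"
  have "\<forall>(l, r)\<in>MV_base. derivable E (subst ?s l) (subst ?s r)"
    using derivable_axiom E by blast
  then show
    "derivable E (t \<^bold>\<oplus> u) (u \<^bold>\<oplus> t)"
    "derivable E (t \<^bold>\<oplus> (u \<^bold>\<oplus> v)) (t \<^bold>\<oplus> u \<^bold>\<oplus> v)"
    "derivable E (t \<^bold>\<oplus> \<^bold>\<not> t) One"
    "derivable E (t \<^bold>\<oplus> One) One"
    "derivable E (t \<^bold>\<oplus> Zero) t"
    "derivable E (\<^bold>\<not> (t \<^bold>\<oplus> u)) (\<^bold>\<not> t \<^bold>\<odot> \<^bold>\<not> u)"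
    "derivable E (\<^bold>\<not> (t \<^bold>\<odot> u)) (\<^bold>\<not> t \<^bold>\<oplus> \<^bold>\<not> u)"
    "derivable E t (\<^bold>\<not> (\<^bold>\<not> t))"
    "derivable E (\<^bold>\<not> Zero) One"
    "derivable E (t \<^bold>\<odot> \<^bold>\<not> u \<^bold>\<oplus> u) (u \<^bold>\<odot> \<^bold>\<not> t \<^bold>\<oplus> t)"
    by (simp_all add: MV_base_def Let_def)
qed

lemma derivable_neg_neg: "derivable E (\<^bold>\<not> (\<^bold>\<not> t)) t"
  by (rule derivable_sym[OF MV_rules(8)])

lemma derivable_Odot: "derivable E (t \<^bold>\<odot> u) (\<^bold>\<not> (\<^bold>\<not> t \<^bold>\<oplus> \<^bold>\<not> u))"
  by (meson MV_rules derivable_Neg derivable_sym derivable_trans)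

lemma derivable_join:
  "derivable E (\<^bold>\<not> (\<^bold>\<not> t \<^bold>\<oplus> u) \<^bold>\<oplus> u) (\<^bold>\<not> (\<^bold>\<not> u \<^bold>\<oplus> t) \<^bold>\<oplus> t)"
proof -
  have *: "derivable E (\<^bold>\<not> (\<^bold>\<not> t \<^bold>\<oplus> u) \<^bold>\<oplus> u) (t \<^bold>\<odot> \<^bold>\<not> u \<^bold>\<oplus> u)" for t u
    by (meson derivable_Odot derivable_Oplus derivable_Neg derivable_refl derivable_trans
        derivable_sym derivable_neg_neg)
  then show ?thesis
    by (meson MV_rules(10) derivable_sym derivable_trans)
qed

text \<open>If t is provable, then \<sim> t reduces to \<open>Zero\<close> and drops out of the
  sum.\<close>

lemma derivable_mp:
  assumes "derivable E t One" "derivable E (\<^bold>\<not> t \<^bold>\<oplus> u) One"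
  shows "derivable E u One"
proof -
  have "derivable E (\<^bold>\<not> One) Zero"
    by (meson MV_rules(9) derivable_Neg derivable_neg_neg derivable_sym derivable_trans)
  then have "derivable E (\<^bold>\<not> t) Zero"
    using assms(1) derivable_Neg derivable_trans by blast
  then have "derivable E (\<^bold>\<not> t \<^bold>\<oplus> u) u"
    by (meson MV_rules derivable_Oplus derivable_refl derivable_trans)
  then show ?thesis
    using assms(2) derivable_sym derivable_trans by blast
qed

text \<open>When t implies u, the join term of t and u reduces to u; both implications and the
  symmetry of the join identify t with u.\<close>

lemma derivable_antisym:
  assumes "derivable E (\<^bold>\<not> t \<^bold>\<oplus> u) One" "derivable E (\<^bold>\<not> u \<^bold>\<oplus> t) One"
  shows "derivable E t u"
proof -
  have *: "derivable E (\<^bold>\<not> (\<^bold>\<not> t \<^bold>\<oplus> u) \<^bold>\<oplus> u) u" if "derivable E (\<^bold>\<not> t \<^bold>\<oplus> u) One" for t u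
  proof -
    have "derivable E (\<^bold>\<not> (\<^bold>\<not> t \<^bold>\<oplus> u)) Zero"
      by (meson that MV_rules(9) derivable_Neg derivable_neg_neg derivable_sym derivable_trans)
    then show ?thesis
      by (meson MV_rules derivable_Oplus derivable_refl derivable_trans)
  qed
  show ?thesis
    by (meson * assms derivable_join derivable_sym derivable_trans)
qed

lemma derivable_imp:
  assumes "derivable E t u" shows "derivable E (\<^bold>\<not> t \<^bold>\<oplus> u) One"
  by (meson assms MV_rules derivable_Oplus derivable_Neg derivable_refl derivable_sym derivable_trans)

end

text \<open>A type cannot depend on \<open>k\<close>, so only the base axioms are factored out here; the additional
  axioms of \<open>MV k\<close> enter through the deductive set \<open>MV_filter k\<close>.\<close>

quotient_type lindenbaum = form / "derivable MV_base"
  by (intro equivpI reflpI sympI transpI)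
    (auto intro: derivable_refl derivable_sym derivable_trans)

instantiation lindenbaum :: mv_algebra
begin

lift_definition add_lindenbaum :: "lindenbaum \<Rightarrow> lindenbaum \<Rightarrow> lindenbaum" is Oplus
  by (rule derivable_Oplus)

lift_definition neg_lindenbaum :: "lindenbaum \<Rightarrow> lindenbaum" is Neg
  by (rule derivable_Neg)

lift_definition bot_lindenbaum :: lindenbaum is Zero .

instance
proof (standard; transfer)
  fix x y z
  show "derivable MV_base (x \<^bold>\<oplus> y) (y \<^bold>\<oplus> x)"
    by (rule MV_rules) simp
  show "derivable MV_base (x \<^bold>\<oplus> y \<^bold>\<oplus> z) (x \<^bold>\<oplus> (y \<^bold>\<oplus> z))"
    by (rule derivable_sym, rule MV_rules) simp
  show "derivable MV_base (x \<^bold>\<oplus> Zero) x"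
    by (rule MV_rules) simp
  show "derivable MV_base (\<^bold>\<not> (\<^bold>\<not> x)) x"
    by (rule derivable_neg_neg) simp
  show "derivable MV_base (x \<^bold>\<oplus> \<^bold>\<not> Zero) (\<^bold>\<not> Zero)"
    by (meson MV_rules order_refl derivable_Oplus derivable_refl derivable_sym derivable_trans)
  show "derivable MV_base (\<^bold>\<not> (\<^bold>\<not> x \<^bold>\<oplus> y) \<^bold>\<oplus> y) (\<^bold>\<not> (\<^bold>\<not> y \<^bold>\<oplus> x) \<^bold>\<oplus> x)"
    by (rule derivable_join) simp
qed

end

section \<open>Classes of formulae, valuations and completeness\<close>

lift_definition cls :: "form \<Rightarrow> lindenbaum" is "\<lambda>t. t" .

lemma cls_simps:
  "cls Zero = \<zero>" "cls One = \<sim> \<zero>" "cls (t \<^bold>\<oplus> u) = cls t \<oplus> cls u" "cls (\<^bold>\<not> t) = \<sim> cls t"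
  "cls (t \<^bold>\<odot> u) = \<sim> (\<sim> cls t \<oplus> \<sim> cls u)"
  by (transfer, auto intro: derivable_refl derivable_sym MV_rules(9) derivable_Odot)+

lemma cls_surj: "\<exists>t. cls t = x"
  by transfer (auto intro: derivable_refl)

lemma cls_eqD: "cls t = cls u \<Longrightarrow> derivable MV_base t u"
  by transfer

primrec eval :: "(nat \<Rightarrow> real) \<Rightarrow> form \<Rightarrow> real" where
  "eval e (Var i) = e i"
| "eval e Zero = 0"
| "eval e One = 1"
| "eval e (t \<^bold>\<oplus> u) = min 1 (eval e t + eval e u)"
| "eval e (t \<^bold>\<odot> u) = max 0 (eval e t + eval e u - 1)"
| "eval e (\<^bold>\<not> t) = 1 - eval e t"

lemma MV_base_subset: "MV_base \<subseteq> MV k"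
  by (auto simp: MV_def Let_def)

definition MV_filter :: "nat \<Rightarrow> lindenbaum set" where
  "MV_filter k = {cls t | t. derivable (MV k) t One}"

text \<open>The choice of representative is immaterial, since base derivations are also derivations
  in \<open>MV k\<close>.\<close>

lemma cls_in_MV_filter: "cls t \<in> MV_filter k \<longleftrightarrow> derivable (MV k) t One"
  unfolding MV_filter_def mem_Collect_eq
  using cls_eqD derivable_mono[OF MV_base_subset] derivable_trans by metis

lemma imp_in_MV_filter: "cls t \<rightarrow> cls u \<in> MV_filter k \<longleftrightarrow> derivable (MV k) (\<^bold>\<not> t \<^bold>\<oplus> u) One"
  by (simp add: imp_def cls_simps[symmetric] cls_in_MV_filter)

lemma deductive_MV_filter: "deductive (MV_filter k)"
  unfolding deductive_def
proof (intro conjI allI impI)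
  show "\<sim> \<zero> \<in> MV_filter k"
    unfolding cls_simps(2)[symmetric] cls_in_MV_filter by (rule derivable_refl)
  fix x y assume "x \<in> MV_filter k" "x \<rightarrow> y \<in> MV_filter k"
  moreover obtain t u where "x = cls t" and "y = cls u"
    using cls_surj by metis
  ultimately have "derivable (MV k) t One" "derivable (MV k) (\<^bold>\<not> t \<^bold>\<oplus> u) One"
    by (simp_all add: imp_in_MV_filter cls_in_MV_filter)
  then show "y \<in> MV_filter k"
    unfolding \<open>y = cls u\<close> cls_in_MV_filter by (rule derivable_mp[OF MV_base_subset])
qed

lemma nfold_Suc:
  assumes "j \<ge> 1"
  shows "nfold_oplus (Suc j) t = t \<^bold>\<oplus> nfold_oplus j t" "nfold_odot (Suc j) t = t \<^bold>\<odot> nfold_odot j t"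
  using assms by (cases j; simp add: nfold_oplus_def nfold_odot_def)+

lemma nfold_1: "nfold_oplus (Suc 0) t = t" "nfold_odot (Suc 0) t = t"
  by (simp_all add: nfold_oplus_def nfold_odot_def)

lemma cls_nfold_oplus: "j \<ge> 1 \<Longrightarrow> cls (nfold_oplus j t) = mul j (cls t)"
  by (induction j rule: dec_induct) (simp_all add: nfold_1 nfold_Suc cls_simps add_bot)

lemma subst_nfold:
  assumes "j \<ge> 1"
  shows "subst s (nfold_oplus j t) = nfold_oplus j (subst s t)"
    "subst s (nfold_odot j t) = nfold_odot j (subst s t)"
  using assms by (induction j rule: dec_induct) (simp_all add: nfold_1 nfold_Suc)

lemma MV_idem:
  assumes "k \<ge> 1" shows "mul (Suc k) x \<rightarrow> mul k x \<in> MV_filter k"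
proof -
  obtain t where t: "x = cls t"
    using cls_surj by metis
  \<comment> \<open>For k = 1 this pair is the separate axiom that x \<oplus> x equals x.\<close>
  have "(nfold_oplus (k + 1) (Var 0), nfold_oplus k (Var 0)) \<in> MV k"
    by (auto simp: MV_def Let_def nfold_oplus_def)
  from derivable_axiom[OF this, of "\<lambda>_. t"]
  have "derivable (MV k) (nfold_oplus (Suc k) t) (nfold_oplus k t)"
    using assms by (simp add: subst_nfold)
  then have "cls (nfold_oplus (Suc k) t) \<rightarrow> cls (nfold_oplus k t) \<in> MV_filter k"
    using derivable_imp[OF MV_base_subset] imp_in_MV_filter by blast
  then show ?thesis
    using assms by (simp add: cls_nfold_oplus t del: mul.simps)
qed

lemma imp_in_of_derivable:
  assumes "derivable (MV k) t u" "MV_filter k \<subseteq> M"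
  shows "cls t \<rightarrow> cls u \<in> M"
  using assms derivable_imp[OF MV_base_subset] imp_in_MV_filter by blast

theorem MV_complete:
  assumes k: "k \<ge> 1"
    and eq: "\<And>e. range e \<subseteq> {real i / real k | i. i \<le> k} \<Longrightarrow> eval e t = eval e u"
  shows "derivable (MV k) t u"
proof -
  \<comment> \<open>The hypothesis is symmetric in t and u, so one implication, proved for arbitrary
    t and u, is used twice and closed by antisymmetry.\<close>
  have le: "cls t \<rightarrow> cls u \<in> MV_filter k"
    if eq: "\<And>e. range e \<subseteq> {real i / real k | i. i \<le> k} \<Longrightarrow> eval e t = eval e u" for t u
  proof (rule ccontr)
    assume "cls t \<rightarrow> cls u \<notin> MV_filter k"
    then obtain M where M: "prime_filter M" and FM: "MV_filter k \<subseteq> M" and w: "cls t \<rightarrow> cls u \<notin> M"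
      using prime_filter_exists[OF deductive_MV_filter] by metis
    have idem: "mul (Suc k) x \<rightarrow> mul k x \<in> M" for x
      using MV_idem[OF k] FM by blast
    obtain m h where m: "1 \<le> m" "m \<le> k" and h_le [rule_format]: "\<forall>x. h x \<le> m"
      and h_add [rule_format]: "\<forall>x y. h (x \<oplus> y) = min m (h x + h y)"
      and h_neg [rule_format]: "\<forall>x. h (\<sim> x) = m - h x"
      and h_mem [rule_format]: "\<forall>x. h x = m \<longleftrightarrow> x \<in> M" and "\<exists>x. h x = 1"
      by (rule chain_representation[OF M idem])
    then obtain c where c: "h c = 1"
      by blast
    have h_mono: "h x \<le> h y" if "x \<rightarrow> y \<in> M" for x y
      using that h_le[of x] h_le[of y] h_mem[of "x \<rightarrow> y"] by (simp add: imp_def h_add h_neg)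
    have h_bot: "h \<zero> = 0"
      using h_mem[of "\<sim> \<zero>"] M h_le[of \<zero>] m
      by (auto simp: h_neg prime_filter_def deductive_top)
    have h_oplus: "h (cls (nfold_oplus j s)) = min m (j * h (cls s))" if "j \<ge> 1" for j s
      using that h_le[of "cls s"] by (induction j rule: dec_induct)
        (auto simp: nfold_1 nfold_Suc cls_simps h_add min_def)
    have h_odot: "h (cls (nfold_odot j s)) = m - min m (j * (m - h (cls s)))" if "j \<ge> 1" for j s
      using that h_le[of "cls s"] by (induction j rule: dec_induct)
        (auto simp: nfold_1 nfold_Suc cls_simps h_add h_neg min_def)
    have "m dvd k"
    proof (rule ccontr)
      assume ndvd: "\<not> m dvd k"
      then have "m \<noteq> 1" "m \<noteq> k"
        by auto
      then have m2: "2 \<le> m" "m \<le> k - 1"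
        using m by auto
      then have ax: "(nfold_odot (k + 1) (nfold_oplus m (nfold_odot (m - 1) (Var 0))),
          nfold_oplus (k + 1) (nfold_odot m (Var 0))) \<in> MV k"
        using ndvd by (auto simp: MV_def Let_def)
      \<comment> \<open>at \<open>1 - 1/m\<close> the axiom for \<open>j = m\<close> reads \<open>1 = 0\<close>\<close>
      obtain s where s: "cls s = \<sim> c"
        using cls_surj by metis
      have "derivable (MV k) (nfold_odot (k + 1) (nfold_oplus m (nfold_odot (m - 1) s)))
          (nfold_oplus (k + 1) (nfold_odot m s))"
        using derivable_axiom[OF ax, of "\<lambda>_. s"] m2 by (simp add: subst_nfold)
      then have "h (cls (nfold_odot (k + 1) (nfold_oplus m (nfold_odot (m - 1) s))))
          \<le> h (cls (nfold_oplus (k + 1) (nfold_odot m s)))"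
        using h_mono imp_in_of_derivable FM by blast
      \<comment> \<open>Here s has value m - 1. Its m-fold product is 0, while its (m - 1)-fold
        product is 1, whose m-fold sum is m.\<close>
      moreover have "h (cls (nfold_oplus (k + 1) (nfold_odot m s))) = 0"
        using m2 by (simp add: h_oplus h_odot s h_neg c)
      moreover have "h (cls (nfold_odot (k + 1) (nfold_oplus m (nfold_odot (m - 1) s)))) = m"
        using m2 by (simp add: h_oplus h_odot s h_neg c)
      ultimately show False
        using m by simp
    qed
    then obtain q where q: "k = m * q"
      by blast
    \<comment> \<open>The values of h, scaled by 1/m, form a valuation; as h respects the
      connectives, \<open>eval e\<close> computes the scaled h of every formula.\<close>
    define e where "e i = real (h (cls (Var i))) / real m" for i
    have ev: "eval e s = real (h (cls s)) / real m" for s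
    proof (induction s)
      case (Odot s s')
      have "h (cls (s \<^bold>\<odot> s')) = h (cls s) + h (cls s') - m"
        using h_le[of "cls s"] h_le[of "cls s'"] by (simp add: cls_simps h_add h_neg min_def)
      moreover have "eval e s + eval e s' - 1 = (real (h (cls s) + h (cls s')) - real m) / real m"
        using Odot m by (simp add: add_divide_distrib diff_divide_distrib)
      ultimately show ?case
        by (cases "m \<le> h (cls s) + h (cls s')") (auto simp: of_nat_diff divide_nonpos_nonneg)
    next
      case (Oplus s s')
      have "eval e s + eval e s' = real (h (cls s) + h (cls s')) / real m"
        using Oplus by (simp add: add_divide_distrib)
      then show ?case
        using m by (cases "m \<le> h (cls s) + h (cls s')")
          (simp_all add: cls_simps h_add le_divide_eq divide_le_eq min_def)
    next
      case (Neg s)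
      then show ?case
        using h_le[of "cls s"] m by (simp add: cls_simps h_neg of_nat_diff diff_divide_distrib)
    qed (use m in \<open>simp_all add: cls_simps h_neg h_bot e_def\<close>)
    \<comment> \<open>Divisibility enters here: with k = m * q, a fraction over m becomes one over k
      after multiplying its numerator by q.\<close>
    have "e i \<in> {real i / real k | i. i \<le> k}" for i
    proof -
      have "e i = real (h (cls (Var i)) * q) / real k" "h (cls (Var i)) * q \<le> k"
        using k q h_le by (auto simp: e_def)
      then show ?thesis
        by blast
    qed
    then have "eval e t = eval e u"
      by (intro eq) auto
    then have "h (cls t) = h (cls u)"
      using m by (simp add: ev)
    then have "h (cls t \<rightarrow> cls u) = m"
      using h_le[of "cls u"] by (simp add: imp_def h_add h_neg)
    with w show False
      by (simp add: h_mem)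
  qed
  show ?thesis
  proof (rule derivable_antisym[OF MV_base_subset])
    show "derivable (MV k) (\<^bold>\<not> t \<^bold>\<oplus> u) One"
      using le[OF eq] by (simp add: imp_in_MV_filter)
    show "derivable (MV k) (\<^bold>\<not> u \<^bold>\<oplus> t) One"
      using le[OF eq[symmetric]] by (simp add: imp_in_MV_filter)
  qed
qed


section \<open>Soundness of the extraction\<close>

lemma cube_nth: "x \<in> cube d \<Longrightarrow> i < d \<Longrightarrow> 0 \<le> x ! i \<and> x ! i \<le> 1"
  by (force simp: cube_def)

text \<open>Boundedness on the cube is what makes the \<open>Inf\<close> and \<open>Sup\<close> in
  \<open>affine_min\<close> and \<open>affine_max\<close> genuine bounds.\<close>

lemma affine_abs_le:
  assumes "x \<in> cube (length w)"
  shows "\<bar>affine w b x\<bar> \<le> (\<Sum>i<length w. \<bar>w ! i\<bar>) + \<bar>b\<bar>"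
proof -
  have "\<bar>\<Sum>i<length w. w ! i * x ! i\<bar> \<le> (\<Sum>i<length w. \<bar>w ! i\<bar>)"
    using cube_nth[OF assms]
    by (intro order_trans[OF sum_abs] sum_mono) (auto simp: abs_mult intro: mult_left_le)
  then show ?thesis
    by (simp add: affine_def)
qed

lemma affine_between:
  assumes "x \<in> cube (length m)"
  shows "affine_min m b \<le> affine (map of_int m) (of_int b) x"
    and "affine (map of_int m) (of_int b) x \<le> affine_max m b"
proof -
  let ?B = "(\<Sum>i<length m. \<bar>map real_of_int m ! i\<bar>) + \<bar>real_of_int b\<bar>"
  let ?A = "affine (map of_int m) (of_int b) ` cube (length m)"
  have B: "\<bar>a\<bar> \<le> ?B" if "a \<in> ?A" for a
    using that affine_abs_le[of _ "map of_int m" "of_int b"] by auto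
  have "bdd_below ?A"
    by (rule bdd_belowI[of _ "- ?B"]) (use B in \<open>fastforce simp: abs_le_iff\<close>)
  then show "affine_min m b \<le> affine (map of_int m) (of_int b) x"
    unfolding affine_min_def using assms by (intro cInf_lower) auto
  have "bdd_above ?A"
    by (rule bdd_aboveI[of _ "?B"]) (use B in \<open>fastforce simp: abs_le_iff\<close>)
  then show "affine (map of_int m) (of_int b) x \<le> affine_max m b"
    unfolding affine_max_def using assms by (intro cSup_upper) auto
qed

lemma affine_decrement:
  assumes "p < length m"
  shows "affine (map of_int (m[p := m ! p - 1])) b x = affine (map of_int m) b x - x ! p"
proof -
  have "(\<Sum>i<length m. map real_of_int (m[p := m ! p - 1]) ! i * x ! i)
      = (\<Sum>i<length m. map real_of_int m ! i * x ! i - (if i = p then x ! i else 0))"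
    by (intro sum.cong) (auto simp: nth_list_update algebra_simps)
  also have "\<dots> = (\<Sum>i<length m. map real_of_int m ! i * x ! i) - x ! p"
    using assms by (simp add: sum_subtractf)
  finally show ?thesis
    by (simp add: affine_def)
qed

lemma affine_add_bias: "affine w (b + c) x = affine w b x + c"
  by (simp add: affine_def)

lemma affine_uminus: "affine (map of_int (map uminus m)) (1 - b) x = 1 - affine (map of_int m) b x"
  by (simp add: affine_def sum_negf)

text \<open>If g - x is nonnegative, the second factor is 1 and the sum saturates correctly from
  above. If it is nonpositive, the first factor is x and the product truncates correctly from
  below.\<close>

lemma clip_recursion:
  assumes "0 \<le> x" "x \<le> 1"
  shows "max 0 (min 1 (clip (g - x) + x) + clip (g - x + 1) - 1) = clip g"
  using assms by (simp add: clip_def min_def max_def)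

lemma clip_bounds: "0 \<le> clip t" "clip t \<le> 1"
  by (auto simp: clip_def)

lemma clip_uminus: "1 - clip (1 - t) = clip t"
  by (simp add: clip_def min_def max_def)

lemma eval_oplus_simp:
  "0 \<le> eval e u \<Longrightarrow> eval e u \<le> 1 \<Longrightarrow> eval e (oplus_simp t u) = min 1 (eval e t + eval e u)"
  by (simp add: oplus_simp_def)

lemma eval_odot_simp:
  "0 \<le> eval e t \<Longrightarrow> eval e (odot_simp t u) = max 0 (eval e t + eval e u - 1)"
  by (simp add: odot_simp_def)

text \<open>Follows the recursion of \<open>extr\<close>: the bounds settle the constant cases,
  \<open>clip_recursion\<close> a positive leading coefficient and \<open>clip_uminus\<close> a
  negative one.\<close>

lemma eval_extr:
  assumes "x \<in> cube (length m)" "\<And>i. i < length m \<Longrightarrow> e i = x ! i"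
  shows "eval e (extr m b) = clip (affine (map of_int m) (of_int b) x)"
  using assms
proof (induction m b rule: extr.induct)
  case (1 m b)
  let ?f = "affine (map of_int m) (of_int b) x" and ?p = "first_nonzero m"
  note between = affine_between[OF 1(4), of b]
  consider "affine_min m b \<ge> 1" | "\<not> affine_min m b \<ge> 1" "affine_max m b \<le> 0"
    | (nz) "\<not> affine_min m b \<ge> 1" "\<not> affine_max m b \<le> 0" by blast
  then show ?case
  proof cases
    case nz
    have p: "?p < length m"
      using nz by (rule first_nonzero)
    have xp: "0 \<le> x ! ?p" "x ! ?p \<le> 1"
      using cube_nth[OF 1(4) p] by auto
    show ?thesis
    proof (cases "m ! ?p \<ge> 1")
      case True
      have "eval e (extr (m[?p := m ! ?p - 1]) b) = clip (?f - x ! ?p)"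
        using 1(1)[OF nz True] 1(4,5) p by (simp add: affine_decrement)
      moreover have "eval e (extr (m[?p := m ! ?p - 1]) (b + 1)) = clip (?f - x ! ?p + 1)"
        using 1(2)[OF nz True] 1(4,5) p by (simp add: affine_decrement affine_add_bias)
      ultimately show ?thesis
        using nz True 1(5)[OF p] xp clip_bounds[of "?f - x ! ?p"] clip_recursion[OF xp]
        by (subst extr.simps) (simp add: eval_odot_simp eval_oplus_simp)
    next
      case False
      then have "eval e (extr (map uminus m) (1 - b)) = clip (1 - ?f)"
        using 1(3)[OF nz False] 1(4,5) affine_uminus[of m "of_int b" x] by simp
      then show ?thesis
        using nz False by (subst extr.simps) (simp add: clip_uminus)
    qed
  qed (use between in \<open>subst extr.simps; simp add: clip_def\<close>)+
qed

section \<open>Layered evaluation and substitution graphs\<close>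

lemma eval_subst: "eval e (subst s t) = eval (\<lambda>i. eval e (s i)) t"
  by (induction t) simp_all

text \<open>Evaluation on bare lists of levels, consumed from the input side as in
  \<open>convert\<close>; \<open>level_map\<close> instead recurses from the output side.\<close>

definition run :: "node list list \<Rightarrow> real list \<Rightarrow> real list" where
  "run = fold (\<lambda>l x. map (\<lambda>v. local_map v x) l)"

lemma run_simps [simp]:
  "run [] x = x" "run (l # ls) x = run ls (map (\<lambda>v. local_map v x) l)"
  by (simp_all add: run_def)

lemma length_run: "ls \<noteq> [] \<Longrightarrow> length (run ls x) = length (last ls)"
  by (induction ls arbitrary: x rule: rev_induct) (simp_all add: run_def)

lemma level_map_run: "j \<le> depth N \<Longrightarrow> level_map N j x = run (take j (layers N)) x"
  by (induction j) (simp_all add: take_Suc_conv_app_nth run_def)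

text \<open>Shape and integrality in one recursion, with d the width of the preceding level, so that
  inductions can strip the first level.\<close>

fun well_formed :: "nat \<Rightarrow> node list list \<Rightarrow> bool" where
  "well_formed d [] \<longleftrightarrow> True"
| "well_formed d (l # ls) \<longleftrightarrow> l \<noteq> [] \<and> (\<forall>v\<in>set l. length (weights v) = d \<and> set (weights v) \<subseteq> \<int> \<and> bias v \<in> \<int>) \<and>
    well_formed (length l) ls"

lemma well_formedI:
  assumes "\<And>j. j < length ls \<Longrightarrow> ls ! j \<noteq> []"
    and "\<And>j v. j < length ls \<Longrightarrow> v \<in> set (ls ! j) \<Longrightarrow>
      length (weights v) = (if j = 0 then d else length (ls ! (j - 1))) \<and>
      set (weights v) \<subseteq> \<int> \<and> bias v \<in> \<int>"
  shows "well_formed d ls"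
  using assms
proof (induction ls arbitrary: d)
  case (Cons l ls)
  have "well_formed (length l) ls"
  proof (rule Cons.IH)
    fix j assume "j < length ls"
    then show "ls ! j \<noteq> []"
      using Cons.prems(1)[of "Suc j"] by simp
  next
    fix j v assume "j < length ls" "v \<in> set (ls ! j)"
    then show "length (weights v) = (if j = 0 then length l else length (ls ! (j - 1))) \<and>
        set (weights v) \<subseteq> \<int> \<and> bias v \<in> \<int>"
      using Cons.prems(2)[of "Suc j" v] by (cases j) auto
  qed
  then show ?case
    using Cons.prems(1)[of 0] Cons.prems(2)[of 0] by auto
qed simp

lemma well_formed_network:
  assumes "layered N" "integer_network N"
  shows "well_formed (inputs N) (layers N)"
proof (rule well_formedI)
  fix j assume j: "j < length (layers N)"
  have lay: "\<And>j. j \<le> depth N \<Longrightarrow> 1 \<le> width N j"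
    "\<And>j i. j \<in> {1..depth N} \<Longrightarrow> i < width N j \<Longrightarrow> length (weights (net_node N j i)) = width N (j - 1)"
    using assms(1) by (auto simp: layered_def)
  show "layers N ! j \<noteq> []"
    using lay(1)[of "Suc j"] j by (auto simp: width_def)
  fix v assume "v \<in> set (layers N ! j)"
  then obtain i where i: "i < length (layers N ! j)" "v = layers N ! j ! i"
    by (metis in_set_conv_nth)
  then have "v = net_node N (Suc j) i" "i < width N (Suc j)" "Suc j \<in> {1..depth N}"
    using j by (auto simp: net_node_def width_def)
  then show "length (weights v) = (if j = 0 then inputs N else length (layers N ! (j - 1))) \<and>
      set (weights v) \<subseteq> \<int> \<and> bias v \<in> \<int>"
    using lay(2)[of "Suc j" i] assms(2) by (auto simp: integer_network_def width_def)
qed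

lemma map_floor_Ints: "set w \<subseteq> \<int> \<Longrightarrow> map of_int (map floor w) = (w :: real list)"
  by (induction w) (auto elim: Ints_cases)

definition extr_level :: "node list \<Rightarrow> form list" where
  "extr_level l = map (\<lambda>v. extr (map floor (weights v)) \<lfloor>bias v\<rfloor>) l"

lemma eval_extr_node:
  assumes "x \<in> cube d" "\<And>i. i < d \<Longrightarrow> e i = x ! i"
    and "length (weights v) = d" "set (weights v) \<subseteq> \<int>" "bias v \<in> \<int>" "act v = clip"
  shows "eval e (extr (map floor (weights v)) \<lfloor>bias v\<rfloor>) = local_map v x"
proof -
  have "eval e (extr (map floor (weights v)) \<lfloor>bias v\<rfloor>)
      = clip (affine (map of_int (map floor (weights v))) (of_int \<lfloor>bias v\<rfloor>) x)"
    using assms by (intro eval_extr) auto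
  also have "\<dots> = local_map v x"
    unfolding map_floor_Ints[OF assms(4)] using assms(5,6) by (auto simp: local_map_def elim: Ints_cases)
  finally show ?thesis .
qed

lemma run_level_cube:
  assumes "\<And>v. v \<in> set l \<Longrightarrow> act v = clip"
  shows "map (\<lambda>v. local_map v x) l \<in> cube (length l)"
  using assms by (auto simp: cube_def local_map_def clip_bounds)

text \<open>Substituting the formulae of the first level amounts to replacing the valuation by the
  outputs of that level. These are clipped, hence lie in the cube again, and the induction continues
  from there.\<close>

lemma eval_represented_levels:
  assumes "well_formed d ls" "ls \<noteq> []" "\<And>l v. l \<in> set ls \<Longrightarrow> v \<in> set l \<Longrightarrow> act v = clip"
    and "x \<in> cube d" "\<And>i. i < d \<Longrightarrow> e i = x ! i"
  shows "eval e (foldr (\<lambda>level. subst (\<lambda>i. level ! i)) (butlast (map extr_level ls))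
    (hd (last (map extr_level ls)))) = hd (run ls x)"
  using assms
proof (induction ls arbitrary: d x e)
  case (Cons l ls)
  have l: "eval e (extr_level l ! i) = local_map (l ! i) x" if "i < length l" for i
  proof -
    have "eval e (extr (map floor (weights (l ! i))) \<lfloor>bias (l ! i)\<rfloor>) = local_map (l ! i) x"
      using that Cons.prems(1) Cons.prems(3)[of l "l ! i"]
      by (intro eval_extr_node[OF Cons.prems(4,5)]) auto
    then show ?thesis
      using that by (simp add: extr_level_def)
  qed
  show ?case
  proof (cases "ls = []")
    case True
    then show ?thesis
      using l[of 0] Cons.prems(1) by (simp add: hd_conv_nth hd_map extr_level_def)
  next
    case False
    let ?e = "\<lambda>i. eval e (extr_level l ! i)" and ?x = "map (\<lambda>v. local_map v x) l"
    have "eval ?e (foldr (\<lambda>level. subst (\<lambda>i. level ! i)) (butlast (map extr_level ls))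
        (hd (last (map extr_level ls)))) = hd (run ls ?x)"
    proof (rule Cons.IH)
      show "well_formed (length l) ls"
        using Cons.prems(1) by simp
      show "?x \<in> cube (length l)"
        by (intro run_level_cube Cons.prems(3)[of l]) simp_all
      show "act v = clip" if "k \<in> set ls" "v \<in> set k" for k v
        using that Cons.prems(3)[of k v] by simp
    qed (use False l in simp_all)
    then show ?thesis
      using False by (simp add: eval_subst)
  qed
qed simp

section \<open>Replacing ReLU nodes by clipped copies\<close>

lemma affine_sum_list:
  "length x = length w \<Longrightarrow> affine w b x = sum_list (map2 (*) w x) + b"
  by (simp add: affine_def sum_list_sum_nth lessThan_atLeast0)

lemma sum_list_map2_replicate:
  "sum_list (map2 (*) (replicate (length ys) a) ys) = (a :: real) * sum_list ys"
  by (induction ys) (simp_all add: algebra_simps)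

text \<open>A weight repeated along a block of values acts as that weight on the sum of the
  block.\<close>

lemma sum_list_blocks:
  "length w = length yss \<Longrightarrow> sum_list (map2 (*) (concat (map2 replicate (map length yss) w)) (concat yss))
    = sum_list (map2 (*) w (map sum_list yss :: real list))"
  by (induction w yss rule: list_induct2) (simp_all add: sum_list_map2_replicate)

lemma length_blocks:
  "length w = length cs \<Longrightarrow> length (concat (map2 replicate cs w)) = sum_list cs"
  by (induction w cs rule: list_induct2) simp_all

lemma set_blocks: "set (concat (map2 replicate cs w)) \<subseteq> set w"
  by (auto dest: set_zip_rightD)

text \<open>Each shifted clip contributes one unit slice, so n of them rebuild the ReLU up to height
  n.\<close>

lemma sum_clip: "(\<Sum>i<n. clip (t - real i)) = max 0 (min t (real n))"
  by (induction n) (auto simp: clip_def min_def max_def)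

lemma affine_le_upper_bound:
  assumes "x \<in> cube (length (weights v))"
  shows "affine (weights v) (bias v) x \<le> upper_bound v"
proof -
  have "(\<Sum>i<length (weights v). weights v ! i * x ! i) \<le> (\<Sum>i<length (weights v). max (weights v ! i) 0)"
  proof (rule sum_mono)
    fix i assume "i \<in> {..<length (weights v)}"
    then have "0 \<le> x ! i" "x ! i \<le> 1"
      using cube_nth[OF assms] by auto
    then show "weights v ! i * x ! i \<le> max (weights v ! i) 0"
      by (cases "weights v ! i \<ge> 0") (auto intro: mult_left_le mult_nonpos_nonneg simp: max_def)
  qed
  then show ?thesis
    by (simp add: affine_def upper_bound_def sum_list_sum_nth lessThan_atLeast0)
qed

text \<open>On the cube the pre-activation never exceeds \<open>upper_bound v\<close>, so the slices
  provided by \<open>copies\<close> are enough.\<close>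

lemma sum_copies:
  assumes "x \<in> cube (length (weights v))" "act v = relu"
  shows "(\<Sum>u\<leftarrow>copies v. local_map u x) = local_map v x"
proof (cases "upper_bound v \<le> 1")
  case True
  then show ?thesis
    using assms affine_le_upper_bound[OF assms(1)]
    by (simp add: copies_def local_map_def relu_def clip_def min_def)
next
  case False
  let ?t = "affine (weights v) (bias v) x" and ?n = "nat \<lceil>upper_bound v\<rceil>"
  have "?t \<le> real ?n"
    using affine_le_upper_bound[OF assms(1)] False by linarith
  moreover have "(\<Sum>u\<leftarrow>copies v. local_map u x) = (\<Sum>i<?n. clip (?t - real i))"
    using False by (simp add: copies_def local_map_def o_def affine_def interv_sum_list_conv_sum_set_nat
        lessThan_atLeast0 algebra_simps)
  ultimately show ?thesis
    using assms(2) by (simp add: sum_clip local_map_def relu_def max.commute)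
qed

lemma copies_props:
  assumes "u \<in> set (copies v)"
  shows "act u = clip" "weights u = weights v" "bias v \<in> \<int> \<Longrightarrow> bias u \<in> \<int>"
  using assms by (auto simp: copies_def split: if_splits)

lemma copies_nonempty: "copies v \<noteq> []"
  by (simp add: copies_def)

lemma repeat_weights_simps [simp]:
  "act (repeat_weights cs v) = act v" "bias (repeat_weights cs v) = bias v"
  "weights (repeat_weights cs v) = concat (map2 replicate cs (weights v))"
  by (simp_all add: repeat_weights_def)

lemma local_map_repeat_weights:
  assumes "length (weights v) = length l" "x \<in> cube d"
    "\<And>u. u \<in> set l \<Longrightarrow> length (weights u) = d \<and> act u = relu"
  shows "local_map (repeat_weights (map (length \<circ> copies) l) v)
      (map (\<lambda>v. local_map v x) (concat (map copies l)))
    = local_map v (map (\<lambda>v. local_map v x) l)"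
proof -
  \<comment> \<open>One block of values per original node, holding the outputs of its
    copies.\<close>
  define yss where "yss = map (\<lambda>u. map (\<lambda>v. local_map v x) (copies u)) l"
  have cs: "map (length \<circ> copies) l = map length yss"
    by (simp add: yss_def)
  have y: "map (\<lambda>v. local_map v x) (concat (map copies l)) = concat yss"
    by (simp add: yss_def map_concat o_def)
  have z: "map (\<lambda>v. local_map v x) l = map sum_list yss"
    using assms sum_copies[of x] by (simp add: yss_def o_def)
  have len: "length (weights v) = length yss"
    using assms(1) by (simp add: yss_def)
  have "length (concat yss) = length (concat (map2 replicate (map length yss) (weights v)))"
    using length_blocks[of "weights v" "map length yss"] len by (simp add: length_concat)
  then show ?thesis
    unfolding cs y z using len by (simp add: local_map_def affine_sum_list sum_list_blocks)
qed

text \<open>Once the first level is split, the rest is a ReLU network with repeated weights fed from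
  the cube, so the induction hypothesis applies to it. Hidden values are preserved in blockwise
  sums, and only the output acquires a clip.\<close>

lemma convert_correct:
  assumes "well_formed d ls" "ls \<noteq> []"
    and "\<And>l v. l \<in> set (butlast ls) \<Longrightarrow> v \<in> set l \<Longrightarrow> act v = relu"
    and "\<And>v. v \<in> set (last ls) \<Longrightarrow> act v = id"
  shows "convert ls \<noteq> [] \<and> well_formed d (convert ls) \<and>
    (\<forall>l\<in>set (convert ls). \<forall>v\<in>set l. act v = clip) \<and>
    (\<forall>x\<in>cube d. run (convert ls) x = map clip (run ls x))"
  using assms
proof (induction ls arbitrary: d rule: convert.induct)
  case (2 l)
  then show ?case
    by (auto simp: local_map_def)
next
  case (3 l l' ls)
  let ?l = "concat (map copies l)" and ?rep = "repeat_weights (map (length \<circ> copies) l)"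
  let ?C = "convert (map ?rep l' # ls)"
  have relu: "\<And>v. v \<in> set l \<Longrightarrow> act v = relu"
    using "3.prems"(3)[of l] by simp
  have len: "length ?l = sum_list (map (length \<circ> copies) l)"
    by (simp add: length_concat)
  have IH: "?C \<noteq> [] \<and> well_formed (length ?l) ?C \<and> (\<forall>l\<in>set ?C. \<forall>v\<in>set l. act v = clip) \<and>
      (\<forall>x\<in>cube (length ?l). run ?C x = map clip (run (map ?rep l' # ls) x))"
  proof (rule "3.IH")
    show "well_formed (length ?l) (map ?rep l' # ls)"
      using "3.prems"(1) set_blocks by (fastforce simp: len length_blocks)
    show "act v = relu" if "k \<in> set (butlast (map ?rep l' # ls))" "v \<in> set k" for k v
      using that "3.prems"(3)[of l'] "3.prems"(3)[of k] by (auto split: if_splits)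
    show "act v = id" if "v \<in> set (last (map ?rep l' # ls))" for v
      using that "3.prems"(4) by (auto split: if_splits)
  qed simp
  have "well_formed d (?l # ?C)"
    using "3.prems"(1) IH copies_props copies_nonempty by auto
  moreover have "run (?l # ?C) x = map clip (run (l # l' # ls) x)" if x: "x \<in> cube d" for x
  proof -
    have "map (\<lambda>v. local_map v x) ?l \<in> cube (length ?l)"
      by (intro run_level_cube) (auto dest: copies_props)
    then have "run (?l # ?C) x = map clip (run (map ?rep l' # ls) (map (\<lambda>v. local_map v x) ?l))"
      using IH by simp
    also have "run (map ?rep l' # ls) (map (\<lambda>v. local_map v x) ?l) = run (l # l' # ls) x"
      using "3.prems"(1) relu x by (simp add: o_def local_map_repeat_weights[of _ l x d, unfolded o_def] cong: map_cong)
    finally show ?thesis .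
  qed
  ultimately show ?case
    using IH copies_props(1) by auto
qed simp

text \<open>Combines the correctness of the conversion with that of the node formulae.\<close>

lemma eval_represented_ext:
  assumes N: "N \<in> network_class n" and x: "x \<in> cube n" and e: "\<And>i. i < n \<Longrightarrow> e i = x ! i"
  shows "eval e (represented (ext N)) = realized_map N x"
proof -
  let ?ls = "layers N" and ?C = "convert (layers N)"
  have N': "relu_network N" "layered N" "integer_network N" "inputs N = n"
      "realized_map N ` cube n \<subseteq> {0..1}"
    using N by (auto simp: network_class_def relu_network_def)
  have ne: "?ls \<noteq> []"
    using N'(2) by (auto simp: layered_def)
  then have len: "length (last ?ls) = 1"
    using N'(2) by (simp add: layered_def width_def last_conv_nth)
  have wf: "well_formed n ?ls"
    using well_formed_network N' by blast
  have relu: "act v = relu" if l: "l \<in> set (butlast ?ls)" "v \<in> set l" for l v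
  proof -
    obtain j where j: "j < length ?ls - 1" "l = ?ls ! j"
      using l by (metis in_set_conv_nth length_butlast nth_butlast)
    obtain i where i: "i < length l" "v = l ! i"
      using l by (metis in_set_conv_nth)
    have "v = net_node N (Suc j) i" "i < width N (Suc j)" "Suc j \<in> {1..<depth N}"
      using i j by (auto simp: net_node_def width_def)
    then show ?thesis
      using N'(1) by (auto simp: relu_network_def)
  qed
  have out: "act v = id" if v: "v \<in> set (last ?ls)" for v
  proof -
    have "v = last ?ls ! 0"
      using v len by (metis One_nat_def in_set_conv_nth less_Suc0)
    then have "v = net_node N (depth N) 0"
      using ne by (simp add: net_node_def last_conv_nth)
    then show ?thesis
      using N'(1) by (simp add: relu_network_def)
  qed
  have C: "?C \<noteq> []" "well_formed n ?C" "\<And>l v. l \<in> set ?C \<Longrightarrow> v \<in> set l \<Longrightarrow> act v = clip"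
      "run ?C x = map clip (run ?ls x)"
    using convert_correct[OF wf ne relu out] x by auto
  have run: "run ?ls x \<noteq> []"
    using len by (auto simp: length_run[OF ne] simp flip: length_greater_0_conv)
  then have real: "hd (run ?ls x) = realized_map N x"
    by (simp add: realized_map_def global_map_def level_map_run hd_conv_nth)
  \<comment> \<open>Level 0 substitutes variables for themselves; it is absorbed into the valuation,
    which agrees with e below n.\<close>
  have "eval e (represented (ext N)) = eval (\<lambda>i. eval e (map Var [0..<n] ! i))
      (foldr (\<lambda>level. subst (\<lambda>i. level ! i)) (butlast (map extr_level ?C)) (hd (last (map extr_level ?C))))"
    using C(1) N'(4) by (simp add: represented_def ext_def step_I_def eval_subst
        extr_level_def[abs_def, symmetric])
  also have "\<dots> = hd (run ?C x)"
    using C x e by (intro eval_represented_levels) auto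
  also have "\<dots> = clip (realized_map N x)"
    using C(4) run by (simp add: hd_map real)
  \<comment> \<open>The clip at the output is harmless because the network is [0,1]-valued on the
    cube.\<close>
  also have "\<dots> = realized_map N x"
    using N'(5) x by (auto simp: clip_def image_subset_iff)
  finally show ?thesis .
qed

theorem theorem6:
  fixes n k :: nat
  assumes "n \<ge> 1" and "k \<ge> 1"
  shows "completely_identifies (MV k) (network_class n) (grid k n)"
  unfolding completely_identifies_def net_derivable_def
proof (intro ballI impI MV_complete[OF \<open>k \<ge> 1\<close>])
  fix N\<^sub>1 N\<^sub>2 and e :: "nat \<Rightarrow> real"
  assume N: "N\<^sub>1 \<in> network_class n" "N\<^sub>2 \<in> network_class n"
    and eq: "\<forall>x\<in>grid k n. realized_map N\<^sub>1 x = realized_map N\<^sub>2 x"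
    and e: "range e \<subseteq> {real i / real k | i. i \<le> k}"
  \<comment> \<open>The first n values of a valuation in the finite chain form a grid point, where
    the two networks agree by assumption.\<close>
  define x where "x = map e [0..<n]"
  have grid: "x \<in> grid k n"
    using e by (auto simp: grid_def x_def)
  have "{real i / real k | i. i \<le> k} \<subseteq> {0..1}"
    using \<open>k \<ge> 1\<close> by (auto simp: divide_le_eq)
  then have cube: "x \<in> cube n"
    using grid by (auto simp: grid_def cube_def)
  have "e i = x ! i" if "i < n" for i
    using that by (simp add: x_def)
  then show "eval e (represented (ext N\<^sub>1)) = eval e (represented (ext N\<^sub>2))"
    using eval_represented_ext[OF _ cube] N eq grid by auto
qed

end
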